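(* Let $G$ be a finite group and $\mathbb K$ a field of characteristic zero. For every $n>0$, the graded piece $R^n_{\mathbb K}(G)$ is $|G|$-torsion, i.e. $|G|\cdot z=0$ for all $z\in R^n_{\mathbb K}(G)$.
   Context: $R_{\mathbb K}(G)$ is the ring of virtual characters of $G$ over $\mathbb K$ (the free abelian group on the characters of irreducible $\mathbb K$-representations, with product induced by tensor product; equivalently the Grothendieck ring of finitely generated $\mathbb K G$-modules), with augmentation $\epsilon:R_{\mathbb K}(G)\to\mathbb Z$ the degree map and $I=\ker\epsilon$. Exterior powers of representations give maps $\lambda^n$ on characters, extended to $R_{\mathbb K}(G)$ by requiring $\lambda^0=1$ and $\lambda^n(x+y)=\sum_{i+j=n}\lambda^i(x)\lambda^j(y)$. Put $\gamma^n(x)=\lambda^n(x+n-1)$. Let $\Gamma^n\subseteq R_{\mathbb K}(G)$ be the additive subgroup generated by all products $\gamma^{i_1}(x_1)\cdots\gamma^{i_r}(x_r)$ with $x_j\in I$ and $\sum_j i_j\ge n$; then $\Gamma^0=R_{\mathbb K}(G)$, $\Gamma^1=I$, $\Gamma^m\Gamma^n\subseteq\Gamma^{m+n}$. The graded character ring is $R^*_{\mathbb K}(G)=\bigoplus_{n\ge0}R^n_{\mathbb K}(G)$ with $R^n_{\mathbb K}(G)=\Gamma^n/\Gamma^{n+1}$. *)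

theory Defs
  imports
    "HOL-Algebra.Generated_Groups"
    "Jordan_Normal_Form.Determinant"
    "Jordan_Normal_Form.VS_Connect"
begin

(* G is a HOL-Algebra group; the coefficient field is the type 'k of class field_char_0.
   Representations are matrix representations. Degree 0 is allowed, so the zero module
   has a character. *)

definition representation ::
    "('g, 'b) monoid_scheme \<Rightarrow> nat \<Rightarrow> ('g \<Rightarrow> 'k::field_char_0 mat) \<Rightarrow> bool" where
  "representation G d \<rho> \<longleftrightarrow>
     (\<forall>g\<in>carrier G. \<rho> g \<in> carrier_mat d d) \<and>
     \<rho> \<one>\<^bsub>G\<^esub> = 1\<^sub>m d \<and>
     (\<forall>g\<in>carrier G. \<forall>h\<in>carrier G. \<rho> (g \<otimes>\<^bsub>G\<^esub> h) = \<rho> g * \<rho> h)"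

definition irreducible_representation ::
    "('g, 'b) monoid_scheme \<Rightarrow> nat \<Rightarrow> ('g \<Rightarrow> 'k::field_char_0 mat) \<Rightarrow> bool" where
  "irreducible_representation G d \<rho> \<longleftrightarrow>
     representation G d \<rho> \<and> 0 < d \<and>
     (\<forall>W. VectorSpace.subspace (class_ring :: 'k ring) W (module_vec TYPE('k) d) \<and>
          (\<forall>g\<in>carrier G. \<forall>w\<in>W. \<rho> g *\<^sub>v w \<in> W)
        \<longrightarrow> W = {0\<^sub>v d} \<or> W = carrier_vec d)"

definition mat_trace :: "'k::comm_ring_1 mat \<Rightarrow> 'k" where
  "mat_trace A = (\<Sum>i<dim_row A. A $$ (i, i))"

(* Characters are extended by 0 outside carrier G, so that equality of characters is equality
   of HOL functions and pointwise sums and products stay within this class of functions. *)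

definition character ::
    "('g, 'b) monoid_scheme \<Rightarrow> ('g \<Rightarrow> 'k::field_char_0 mat) \<Rightarrow> 'g \<Rightarrow> 'k" where
  "character G \<rho> = (\<lambda>g. if g \<in> carrier G then mat_trace (\<rho> g) else 0)"

definition irreducible_characters ::
    "('g, 'b) monoid_scheme \<Rightarrow> ('g \<Rightarrow> 'k::field_char_0) set" where
  "irreducible_characters G = {character G \<rho> | d \<rho>. irreducible_representation G d \<rho>}"

(* The integral span of the irreducible characters inside the 'k-valued functions. It is free
   on them because distinct irreducible characters are linearly independent in
   characteristic 0. The product is pointwise because the character of a tensor product is the
   pointwise product of the characters, see character_tensor below. *)

definition virtual_characters ::
    "('g, 'b) monoid_scheme \<Rightarrow> ('g \<Rightarrow> 'k::field_char_0) set" where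
  "virtual_characters G =
     {\<lambda>g. \<Sum>\<chi>\<in>S. of_int (c \<chi>) * \<chi> g | S (c :: ('g \<Rightarrow> 'k) \<Rightarrow> int).
        finite S \<and> S \<subseteq> irreducible_characters G}"

definition character_ring ::
    "('g, 'b) monoid_scheme \<Rightarrow> ('g \<Rightarrow> 'k::field_char_0) ring" where
  "character_ring G =
     \<lparr>carrier = virtual_characters G,
      monoid.mult = (\<lambda>x y g. x g * y g),
      one = (\<lambda>g. if g \<in> carrier G then 1 else 0),
      zero = (\<lambda>g. 0),
      add = (\<lambda>x y g. x g + y g)\<rparr>"

definition kronecker :: "'k::comm_ring_1 mat \<Rightarrow> 'k mat \<Rightarrow> 'k mat" where
  "kronecker A B = mat (dim_row A * dim_row B) (dim_col A * dim_col B)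
     (\<lambda>(i, j). A $$ (i div dim_row B, j div dim_col B) * B $$ (i mod dim_row B, j mod dim_col B))"

lemma mat_trace_kronecker:
  assumes "A \<in> carrier_mat m m" and "B \<in> carrier_mat n n"
  shows "mat_trace (kronecker A B) = mat_trace A * mat_trace B"
proof -
  have "mat_trace (kronecker A B) = (\<Sum>i<m * n. A $$ (i div n, i div n) * B $$ (i mod n, i mod n))"
    using assms unfolding mat_trace_def kronecker_def by (intro sum.cong) auto
  also have "\<dots> = (\<Sum>j<m. \<Sum>i\<in>{j * n..<j * n + n}. A $$ (i div n, i div n) * B $$ (i mod n, i mod n))"
    by (rule sum.nat_group [symmetric])
  also have "\<dots> = (\<Sum>j<m. \<Sum>k<n. A $$ (j, j) * B $$ (k, k))"
  proof (rule sum.cong [OF refl])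
    fix j
    have div: "i div n = j" if "i \<in> {j * n..<j * n + n}" for i
      using that by (intro div_nat_eqI) (auto simp: algebra_simps)
    have mod: "i mod n = i - j * n" if "i \<in> {j * n..<j * n + n}" for i
      using div [OF that] by (metis minus_div_mult_eq_mod)
    show "(\<Sum>i\<in>{j * n..<j * n + n}. A $$ (i div n, i div n) * B $$ (i mod n, i mod n))
        = (\<Sum>k<n. A $$ (j, j) * B $$ (k, k))"
      by (rule sum.reindex_bij_witness [where i = "\<lambda>k. j * n + k" and j = "\<lambda>i. i - j * n"])
         (auto simp: div mod)
  qed
  also have "\<dots> = mat_trace A * mat_trace B"
    using assms by (simp add: mat_trace_def sum_product)
  finally show ?thesis .
qed

lemma character_tensor:
  assumes "representation G m \<rho>" and "representation G n \<sigma>"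
  shows "character G (\<lambda>g. kronecker (\<rho> g) (\<sigma> g))
       = character G \<rho> \<otimes>\<^bsub>character_ring G\<^esub> character G \<sigma>"
proof
  fix g
  show "character G (\<lambda>g. kronecker (\<rho> g) (\<sigma> g)) g
      = (character G \<rho> \<otimes>\<^bsub>character_ring G\<^esub> character G \<sigma>) g"
    using assms by (cases "g \<in> carrier G")
      (simp_all add: character_def character_ring_def representation_def
        mat_trace_kronecker [of _ m _ n])
qed

(* The degree map: a virtual character takes its degree, an integer, as its value at the
   identity of G. *)

definition augmentation :: "('g, 'b) monoid_scheme \<Rightarrow> ('g \<Rightarrow> 'k::field_char_0) \<Rightarrow> int" where
  "augmentation G x = (THE k. of_int k = x \<one>\<^bsub>G\<^esub>)"

definition augmentation_ideal ::
    "('g, 'b) monoid_scheme \<Rightarrow> ('g \<Rightarrow> 'k::field_char_0) set" where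
  "augmentation_ideal G = {x \<in> carrier (character_ring G). augmentation G x = 0}"

(* The matrix of the n-th exterior power of A. The basis vectors e_{i_1} \<and> ... \<and> e_{i_n} are
   indexed by the increasing lists [i_1, ..., i_n] of indices, so the entries are the
   n-by-n minors of A. For n = 0 this is the 1-by-1 identity matrix. *)

definition exterior_basis :: "nat \<Rightarrow> nat \<Rightarrow> nat list list" where
  "exterior_basis n d = filter (\<lambda>l. length l = n) (subseqs [0..<d])"

definition exterior_power_mat :: "nat \<Rightarrow> 'k::comm_ring_1 mat \<Rightarrow> 'k mat" where
  "exterior_power_mat n A =
     (let B = exterior_basis n (dim_row A) in
      mat (length B) (length B) (\<lambda>(i, j). det (mat n n (\<lambda>(a, b). A $$ (B ! i ! a, B ! j ! b)))))"

(* The requirements by which the operations \<lambda>^n are defined: they agree with exterior powers on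
   characters of representations and turn sums into convolutions. Values outside the ring are
   fixed to 0, so that L is unique as a HOL function: the series of L n x with x the difference
   of the characters of V and W must be the quotient of the exterior power series of V and W.
   It exists because in characteristic 0 the character of V determines the coefficients of
   det (1 + t \<rho>(g)), which are the characters of its exterior powers. *)

definition is_lambda_family ::
    "('g, 'b) monoid_scheme \<Rightarrow> (nat \<Rightarrow> ('g \<Rightarrow> 'k::field_char_0) \<Rightarrow> 'g \<Rightarrow> 'k) \<Rightarrow> bool" where
  "is_lambda_family G L \<longleftrightarrow>
     (let R = character_ring G in
      (\<forall>n. \<forall>x\<in>carrier R. L n x \<in> carrier R) \<and>
      (\<forall>n x. x \<notin> carrier R \<longrightarrow> L n x = \<zero>\<^bsub>R\<^esub>) \<and>
      (\<forall>n d \<rho>. representation G d \<rho> \<longrightarrow>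
         L n (character G \<rho>) = character G (\<lambda>g. exterior_power_mat n (\<rho> g))) \<and>
      (\<forall>x\<in>carrier R. L 0 x = \<one>\<^bsub>R\<^esub>) \<and>
      (\<forall>n. \<forall>x\<in>carrier R. \<forall>y\<in>carrier R.
         L n (x \<oplus>\<^bsub>R\<^esub> y) = (\<Oplus>\<^bsub>R\<^esub>i\<in>{..n}. L i x \<otimes>\<^bsub>R\<^esub> L (n - i) y)))"

definition lambda_op ::
    "('g, 'b) monoid_scheme \<Rightarrow> nat \<Rightarrow> ('g \<Rightarrow> 'k::field_char_0) \<Rightarrow> 'g \<Rightarrow> 'k" where
  "lambda_op G = (THE L. is_lambda_family G L)"

(* The shift is by the integer n - 1, which is -1 for n = 0. *)

definition gamma_op ::
    "('g, 'b) monoid_scheme \<Rightarrow> nat \<Rightarrow> ('g \<Rightarrow> 'k::field_char_0) \<Rightarrow> 'g \<Rightarrow> 'k" where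
  "gamma_op G n x =
     (let R = character_ring G in lambda_op G n (x \<oplus>\<^bsub>R\<^esub> add_pow R (int n - 1) \<one>\<^bsub>R\<^esub>))"

definition gamma_filtration ::
    "('g, 'b) monoid_scheme \<Rightarrow> nat \<Rightarrow> ('g \<Rightarrow> 'k::field_char_0) set" where
  "gamma_filtration G n =
     generate (add_monoid (character_ring G))
       {\<Otimes>\<^bsub>character_ring G\<^esub>j\<in>{..<r}. gamma_op G (i j) (x j) | (r :: nat) i x.
          (\<forall>j<r. x j \<in> augmentation_ideal G) \<and> n \<le> (\<Sum>j<r. i j)}"

(* The quotient of additive groups Gamma^n / Gamma^(n+1); as a HOL-Algebra group it is written
   multiplicatively. *)

definition graded_piece ::
    "('g, 'b) monoid_scheme \<Rightarrow> nat \<Rightarrow> ('g \<Rightarrow> 'k::field_char_0) set monoid" where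
  "graded_piece G n =
     (add_monoid (character_ring G)) \<lparr>carrier := gamma_filtration G n\<rparr> Mod gamma_filtration G (Suc n)"

end

theory Submission
  imports Defs
    "HOL-Library.Sublist"
    "HOL-Combinatorics.Multiset_Permutations"
    "HOL-Computational_Algebra.Formal_Power_Series"
    "Jordan_Normal_Form.DL_Rank"
begin

text \<open>Let \<open>reg\<close> be the regular character. An element \<open>x\<close> of \<open>\<Gamma>\<^sup>n\<close> with \<open>n > 0\<close> vanishes at the identity,
  so \<open>|G| x = x (|G| - reg)\<close>; since \<open>|G| - reg\<close> lies in \<open>I\<close> and \<open>\<gamma>\<^sup>1\<close> is the identity on \<open>I\<close>, the
  right-hand side lies in \<open>\<Gamma>\<^sup>n\<^sup>+\<^sup>1\<close>.

  What takes work is that the operations \<open>\<lambda>\<^sup>n\<close> exist and are unique. By Newton's identities the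
  character of an exterior power at \<open>g\<close> is the universal polynomial in the values \<open>\<chi>(g\<^sup>k)\<close> that expresses
  elementary symmetric functions through power sums; this polynomial makes sense for every class
  function and turns sums into convolutions. It preserves virtual characters because they are
  differences of characters and exterior powers of representations are representations
  (Cauchy--Binet).\<close>

subsection \<open>The Cauchy--Binet formula\<close>

text \<open>Vanishing at the identity comes from the generators: in positive weight each has a
  factor \<gamma>^m(x) with m > 0 and x of degree 0, and its value at the identity is the dimension
  of the m-th exterior power of a space of dimension m - 1, which is 0.

  The coefficient field need not contain the eigenvalues of the matrices, so Newton's identities are
  derived from determinant expansions and not from triangular forms. To keep the signs of sorting
  permutations out of these expansions, sums of minors run over all lists of n indices, repetitions
  included. Repetitions contribute 0 and each increasing list is counted n! times; characteristic
  zero allows the division by n! and, in Newton's recursion, by n.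

  The definite description behind \<open>lambda_op\<close> says nothing until existence and
  uniqueness are proved. This is why exterior powers and the decomposition of every character into
  irreducible ones have to come before the short argument with the regular character.\<close>

definition index_lists :: "nat \<Rightarrow> nat \<Rightarrow> nat list set" where
  "index_lists n d = {l. set l \<subseteq> {..<d} \<and> length l = n}"

lemma finite_index_lists [simp]: "finite (index_lists n d)"
  unfolding index_lists_def by (rule finite_lists_length_eq) simp

lemma index_lists_0 [simp]: "index_lists 0 d = {[]}"
  by (auto simp: index_lists_def)

lemma nth_index_lists: "l \<in> index_lists n d \<Longrightarrow> i < n \<Longrightarrow> l ! i < d"
  unfolding index_lists_def using nth_mem by fastforce

lemma sum_index_lists_Suc:
  "(\<Sum>l\<in>index_lists (Suc n) d. f l) = (\<Sum>i<d. \<Sum>l\<in>index_lists n d. f (i # l))"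
proof -
  have "(\<Sum>i<d. \<Sum>l\<in>index_lists n d. f (i # l)) = (\<Sum>(i, l)\<in>{..<d} \<times> index_lists n d. f (i # l))"
    by (simp add: sum.cartesian_product)
  also have "\<dots> = (\<Sum>l\<in>index_lists (Suc n) d. f l)"
    by (rule sum.reindex_bij_witness [where i = "\<lambda>l. (hd l, tl l)" and j = "\<lambda>(i, l). i # l"])
      (auto simp: index_lists_def length_Suc_conv)
  finally show ?thesis ..
qed

lemma prod_sum_index_lists:
  fixes f :: "nat \<Rightarrow> nat \<Rightarrow> 'a::comm_ring_1"
  shows "(\<Prod>a<n. \<Sum>k<d. f a k) = (\<Sum>l\<in>index_lists n d. \<Prod>a<n. f a (l ! a))"
proof (induction n arbitrary: f)
  case (Suc n)
  have "(\<Prod>a<Suc n. \<Sum>k<d. f a k) = (\<Sum>k<d. f 0 k) * (\<Prod>a<n. \<Sum>k<d. f (Suc a) k)"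
    by (rule prod.lessThan_Suc_shift)
  also have "\<dots> = (\<Sum>i<d. \<Sum>l\<in>index_lists n d. f 0 i * (\<Prod>a<n. f (Suc a) (l ! a)))"
    by (simp add: Suc sum_product)
  also have "\<dots> = (\<Sum>l\<in>index_lists (Suc n) d. \<Prod>a<Suc n. f a (l ! a))"
    by (subst sum_index_lists_Suc) (simp add: prod.lessThan_Suc_shift del: prod.lessThan_Suc)
  finally show ?case .
qed simp

text \<open>Expanding a bordered minor singles out one position of an index list. Every position
  gives the same sum, which is the origin of the factor \<open>Suc n\<close> in the recursion for
  bordered sums.\<close>

lemma sum_index_lists_remove_nth:
  assumes "b < Suc n"
  shows "(\<Sum>l\<in>index_lists (Suc n) d. f (l ! b) (take b l @ drop (Suc b) l))
       = (\<Sum>i<d. \<Sum>l\<in>index_lists n d. f i l)"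
proof -
  have "(\<Sum>i<d. \<Sum>l\<in>index_lists n d. f i l) = (\<Sum>(i, l)\<in>{..<d} \<times> index_lists n d. f i l)"
    by (simp add: sum.cartesian_product)
  also have "\<dots> = (\<Sum>l\<in>index_lists (Suc n) d. f (l ! b) (take b l @ drop (Suc b) l))"
  proof (rule sum.reindex_bij_witness [where i = "\<lambda>l. (l ! b, take b l @ drop (Suc b) l)"
          and j = "\<lambda>(i, l). take b l @ i # drop b l"], goal_cases)
    case (1 x)
    then show ?case using assms by (auto simp: index_lists_def nth_append min_def)
  next
    case (2 x)
    then show ?case using assms
      by (auto simp: index_lists_def dest: in_set_takeD in_set_dropD)
  next
    case (3 l)
    then show ?case using assms by (simp add: index_lists_def id_take_nth_drop [symmetric])
  next
    case (4 l)
    then have "set (take b l) \<subseteq> {..<d}" "set (drop (Suc b) l) \<subseteq> {..<d}"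
      using set_take_subset set_drop_subset by (fastforce simp: index_lists_def)+
    then show ?case using 4 assms nth_index_lists [OF 4] by (auto simp: index_lists_def)
  next
    case (5 x)
    then show ?case using assms by (auto simp: index_lists_def nth_append min_def)
  qed
  finally show ?thesis ..
qed

lemma sorted_wrt_subseq: "subseq xs ys \<Longrightarrow> sorted_wrt P ys \<Longrightarrow> sorted_wrt P xs"
  by (induction rule: list_emb.induct) (auto dest: list_emb_set)

lemma in_exterior_basis_iff:
  "l \<in> set (exterior_basis n d) \<longleftrightarrow> l \<in> index_lists n d \<and> sorted l \<and> distinct l"
proof -
  have *: "sorted l \<and> distinct l \<and> set l \<subseteq> {..<d}" if "l \<in> set (subseqs [0..<d])" for l
  proof -
    have "subseq l [0..<d]" using that by simp
    moreover from this have "sorted l"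
      by (rule sorted_wrt_subseq) simp
    moreover have "set l \<subseteq> {..<d}"
    proof -
      have "set l \<in> set ` set (subseqs [0..<d])" using that by blast
      then show ?thesis unfolding subseqs_powset by auto
    qed
    ultimately show ?thesis using subseqs_distinctD [OF that] by simp
  qed
  have "l \<in> set (subseqs [0..<d])" if "sorted l" "distinct l" "set l \<subseteq> {..<d}"
  proof -
    \<comment> \<open>Some subsequence has the same set as \<open>l\<close>; it is \<open>l\<close>
      itself, because a sorted duplicate-free list is determined by its set.\<close>
    have "set l \<in> set ` set (subseqs [0..<d])"
      using that by (intro subset_subseqs) auto
    then obtain l' where l': "l' \<in> set (subseqs [0..<d])" "set l = set l'" by blast
    then have "l = l'" using * [OF l'(1)] that by (metis sorted_distinct_set_unique)
    then show ?thesis using l' by simp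
  qed
  with * show ?thesis unfolding exterior_basis_def index_lists_def
    by (auto simp del: in_set_subseqs)
qed

lemma distinct_exterior_basis [simp]: "distinct (exterior_basis n d)"
  unfolding exterior_basis_def
  using distinct_set_subseqs [of "[0..<d]"] by (simp add: distinct_map)

text \<open>Every duplicate-free list of length \<open>n\<close> is one of the \<open>n!\<close> rearrangements of its sorted version.\<close>

lemma sum_index_lists_eq_sum_exterior_basis:
  fixes f :: "nat list \<Rightarrow> 'a::{comm_ring_1, ring_char_0}"
  assumes perm: "\<And>l l'. l \<in> index_lists n d \<Longrightarrow> mset l = mset l' \<Longrightarrow> f l = f l'"
    and nondistinct: "\<And>l. l \<in> index_lists n d \<Longrightarrow> \<not> distinct l \<Longrightarrow> f l = 0"
  shows "(\<Sum>l\<in>index_lists n d. f l) = fact n * (\<Sum>l\<in>set (exterior_basis n d). f l)"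
proof -
  let ?D = "{l \<in> index_lists n d. distinct l}"
  have "(\<Sum>l\<in>index_lists n d. f l) = (\<Sum>l\<in>?D. f l)"
    by (rule sum.mono_neutral_right) (auto intro: nondistinct)
  also have "\<dots> = (\<Sum>k\<in>set (exterior_basis n d). \<Sum>l\<in>{l \<in> ?D. sort l = k}. f l)"
    by (rule sum.group [symmetric]) (simp, simp, auto simp: in_exterior_basis_iff index_lists_def)
  also have "\<dots> = (\<Sum>k\<in>set (exterior_basis n d). fact n * f k)"
  proof (rule sum.cong [OF refl])
    fix k assume "k \<in> set (exterior_basis n d)"
    then have k: "k \<in> index_lists n d" "sorted k" "distinct k"
      by (auto simp: in_exterior_basis_iff)
    have fibre: "{l \<in> ?D. sort l = k} = permutations_of_set (set k)"
    proof (intro equalityI subsetI)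
      fix l assume l: "l \<in> permutations_of_set (set k)"
      then have "set l = set k" "distinct l" by (auto simp: permutations_of_set_def)
      moreover from this have "length l = length k"
        using k(3) by (metis distinct_card)
      moreover from calculation have "sort l = k"
        using k by (intro sorted_distinct_set_unique) auto
      ultimately show "l \<in> {l \<in> ?D. sort l = k}" using k by (auto simp: index_lists_def)
    qed (use k in \<open>auto simp: permutations_of_set_def\<close>)
    have "f l = f k" if "l \<in> {l \<in> ?D. sort l = k}" for l
      using that by (intro perm) auto
    then have "(\<Sum>l\<in>{l \<in> ?D. sort l = k}. f l) = of_nat (card {l \<in> ?D. sort l = k}) * f k"
      by simp
    also have "card {l \<in> ?D. sort l = k} = fact n"
      unfolding fibre using k by (simp add: distinct_card index_lists_def)
    finally show "(\<Sum>l\<in>{l \<in> ?D. sort l = k}. f l) = fact n * f k" by simp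
  qed
  finally show ?thesis by (simp add: sum_distrib_left)
qed

section \<open>Minors indexed by lists and their behaviour under permutations\<close>

definition minor :: "nat \<Rightarrow> 'a::comm_ring_1 mat \<Rightarrow> nat list \<Rightarrow> nat list \<Rightarrow> 'a" where
  "minor n A I J = det (mat n n (\<lambda>(a, b). A $$ (I ! a, J ! b)))"

lemma minor_permute_rows:
  assumes "p permutes {..<n}" "length I = n"
  shows "minor n A (permute_list p I) J = signof p * minor n A I J"
proof -
  have p: "p permutes {0..<n}" using assms by (simp add: atLeast0LessThan)
  have "mat n n (\<lambda>(a, b). A $$ (permute_list p I ! a, J ! b))
      = mat n n (\<lambda>(a, b). mat n n (\<lambda>(a, b). A $$ (I ! a, J ! b)) $$ (p a, b))"
    using assms permutes_in_image [OF assms(1)] by (intro eq_matI) (auto simp: permute_list_nth)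
  then show ?thesis unfolding minor_def by (simp add: det_permute_rows [OF _ p])
qed

lemma minor_transpose:
  assumes "A \<in> carrier_mat d d" "I \<in> index_lists n d" "J \<in> index_lists n d"
  shows "minor n (transpose_mat A) J I = minor n A I J"
proof -
  have "mat n n (\<lambda>(a, b). transpose_mat A $$ (J ! a, I ! b))
      = transpose_mat (mat n n (\<lambda>(a, b). A $$ (I ! a, J ! b)))"
    using assms by (intro eq_matI) (auto simp: nth_index_lists)
  then show ?thesis unfolding minor_def by (simp add: det_transpose [of _ n])
qed

lemma permute_index_lists: "p permutes {..<n} \<Longrightarrow> l \<in> index_lists n d \<Longrightarrow> permute_list p l \<in> index_lists n d"
  by (auto simp: index_lists_def)

lemma minor_permute_cols:
  assumes "p permutes {..<n}" "A \<in> carrier_mat d d" "I \<in> index_lists n d" "J \<in> index_lists n d"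
  shows "minor n A I (permute_list p J) = signof p * minor n A I J"
  using assms minor_permute_rows [OF assms(1), of J "transpose_mat A" I]
  by (simp add: minor_transpose permute_index_lists) (simp add: index_lists_def)

lemma minor_nondistinct_rows:
  assumes "length I = n" "\<not> distinct I"
  shows "minor n A I J = 0"
proof -
  obtain a b where ab: "a < n" "b < n" "a \<noteq> b" "I ! a = I ! b"
    using assms by (auto simp: distinct_conv_nth)
  show ?thesis unfolding minor_def
    by (rule det_identical_rows [of _ n a b]) (use ab in \<open>auto intro!: eq_vecI\<close>)
qed

lemma signof_square: "signof p * signof p = (1 :: 'a::comm_ring_1)"
  by (simp add: sign_def)

lemma minor_Leibniz:
  "minor n A I J = (\<Sum>p | p permutes {..<n}. signof p * (\<Prod>a<n. A $$ (I ! a, J ! p a)))"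
proof -
  have "(\<Prod>a<n. mat n n (\<lambda>(a, b). A $$ (I ! a, J ! b)) $$ (a, p a)) = (\<Prod>a<n. A $$ (I ! a, J ! p a))"
    if "p permutes {..<n}" for p
    using permutes_in_image [OF that] by (intro prod.cong) auto
  then show ?thesis unfolding minor_def
    by (simp add: det_def' [of _ n] atLeast0LessThan)
qed

text \<open>Multilinearity in the rows: each row of the product is a combination of rows of
  \<open>B\<close>. The contribution of \<open>A\<close> is still a plain product of entries and
  becomes a minor only after summing over permutations.\<close>

lemma minor_mult_expand:
  assumes A: "A \<in> carrier_mat d d" and B: "B \<in> carrier_mat d d"
    and I: "I \<in> index_lists n d" and J: "J \<in> index_lists n d"
  shows "minor n (A * B) I J = (\<Sum>l\<in>index_lists n d. (\<Prod>a<n. A $$ (I ! a, l ! a)) * minor n B l J)"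
proof -
  let ?P = "{p. p permutes {..<n}}"
  have entry: "(\<Prod>a<n. (A * B) $$ (I ! a, J ! p a)) = (\<Prod>a<n. \<Sum>k<d. A $$ (I ! a, k) * B $$ (k, J ! p a))"
    if "p permutes {..<n}" for p
    using A B nth_index_lists [OF I] nth_index_lists [OF J] permutes_in_image [OF that]
    by (intro prod.cong) (auto simp: scalar_prod_def atLeast0LessThan)
  have "minor n (A * B) I J = (\<Sum>p\<in>?P. signof p * (\<Prod>a<n. \<Sum>k<d. A $$ (I ! a, k) * B $$ (k, J ! p a)))"
    unfolding minor_Leibniz by (intro sum.cong) (simp_all add: entry)
  also have "\<dots> = (\<Sum>p\<in>?P. \<Sum>l\<in>index_lists n d.
      signof p * ((\<Prod>a<n. A $$ (I ! a, l ! a)) * (\<Prod>a<n. B $$ (l ! a, J ! p a))))"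
    by (simp add: prod_sum_index_lists sum_distrib_left prod.distrib)
  also have "\<dots> = (\<Sum>l\<in>index_lists n d. \<Sum>p\<in>?P.
      signof p * ((\<Prod>a<n. A $$ (I ! a, l ! a)) * (\<Prod>a<n. B $$ (l ! a, J ! p a))))"
    by (rule sum.swap)
  also have "\<dots> = (\<Sum>l\<in>index_lists n d. (\<Prod>a<n. A $$ (I ! a, l ! a)) * minor n B l J)"
    by (simp add: minor_Leibniz sum_distrib_left mult.left_commute)
  finally show ?thesis .
qed

lemma bij_permute_index_lists:
  assumes "p permutes {..<n}"
  shows "bij_betw (permute_list p) (index_lists n d) (index_lists n d)"
proof (rule bij_betw_byWitness [where f' = "permute_list (inv_into UNIV p)"])
  have 1: "permute_list (inv_into UNIV p) (permute_list p l) = l" if "l \<in> index_lists n d" for l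
    using that permutes_inv [OF assms] permutes_inv_o(1) [OF assms]
    by (subst permute_list_compose [symmetric]) (auto simp: index_lists_def)
  have 2: "permute_list p (permute_list (inv_into UNIV p) l) = l" if "l \<in> index_lists n d" for l
    using that assms permutes_inv_o(2) [OF assms]
    by (subst permute_list_compose [symmetric]) (auto simp: index_lists_def)
  from 1 2 show "\<forall>l\<in>index_lists n d. permute_list (inv_into UNIV p) (permute_list p l) = l"
    "\<forall>l\<in>index_lists n d. permute_list p (permute_list (inv_into UNIV p) l) = l" by auto
qed (use assms permutes_inv in \<open>auto intro: permute_index_lists\<close>)

text \<open>Summing over all index lists counts each summand of the Cauchy--Binet formula \<open>n!\<close> times.\<close>

lemma fact_mult_minor_mult:
  fixes A B :: "'a::{comm_ring_1, ring_char_0} mat"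
  assumes A: "A \<in> carrier_mat d d" and B: "B \<in> carrier_mat d d"
    and I: "I \<in> index_lists n d" and J: "J \<in> index_lists n d"
  shows "fact n * minor n (A * B) I J = (\<Sum>l\<in>index_lists n d. minor n A I l * minor n B l J)"
proof -
  let ?P = "{p. p permutes {..<n}}"
  have "minor n (A * B) I J
      = (\<Sum>l\<in>index_lists n d. signof p * (\<Prod>a<n. A $$ (I ! a, l ! p a)) * minor n B l J)"
    if p: "p permutes {..<n}" for p
  proof -
    \<comment> \<open>The index set is stable under permuting positions by \<open>p\<close>. This
      moves \<open>p\<close> into the product of entries of \<open>A\<close> and takes its sign out
      of the minor of \<open>B\<close>, so summing over all \<open>p\<close> produces the Leibniz
      formula for a minor of \<open>A\<close>, while the left side is merely repeated n!
      times.\<close>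
    have "minor n (A * B) I J = (\<Sum>l\<in>index_lists n d.
        (\<Prod>a<n. A $$ (I ! a, permute_list p l ! a)) * minor n B (permute_list p l) J)"
      unfolding minor_mult_expand [OF assms]
      by (rule sum.reindex_bij_betw [OF bij_permute_index_lists [OF p], symmetric])
    also have "\<dots> = (\<Sum>l\<in>index_lists n d. (\<Prod>a<n. A $$ (I ! a, l ! p a)) * (signof p * minor n B l J))"
      using p by (intro sum.cong refl arg_cong2 [where f = "(*)"] prod.cong)
        (auto simp: permute_list_nth minor_permute_rows index_lists_def)
    finally show ?thesis by (simp add: ac_simps)
  qed
  then have "(\<Sum>p\<in>?P. minor n (A * B) I J) = (\<Sum>p\<in>?P. \<Sum>l\<in>index_lists n d.
      signof p * (\<Prod>a<n. A $$ (I ! a, l ! p a)) * minor n B l J)"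
    by (intro sum.cong) auto
  also have "\<dots> = (\<Sum>l\<in>index_lists n d. \<Sum>p\<in>?P.
      signof p * (\<Prod>a<n. A $$ (I ! a, l ! p a)) * minor n B l J)"
    by (rule sum.swap)
  also have "\<dots> = (\<Sum>l\<in>index_lists n d. minor n A I l * minor n B l J)"
    by (simp add: minor_Leibniz [of n A] sum_distrib_right)
  finally show ?thesis by (simp add: card_permutations [OF refl])
qed

theorem Cauchy_Binet:
  fixes A B :: "'a::field_char_0 mat"
  assumes A: "A \<in> carrier_mat d d" and B: "B \<in> carrier_mat d d"
    and I: "I \<in> index_lists n d" and J: "J \<in> index_lists n d"
  shows "minor n (A * B) I J = (\<Sum>l\<in>set (exterior_basis n d). minor n A I l * minor n B l J)"
proof -
  have "(\<Sum>l\<in>index_lists n d. minor n A I l * minor n B l J)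
      = fact n * (\<Sum>l\<in>set (exterior_basis n d). minor n A I l * minor n B l J)"
  proof (rule sum_index_lists_eq_sum_exterior_basis)
    fix l l' :: "nat list" assume l: "l \<in> index_lists n d" and "mset l = mset l'"
    then obtain p where p: "p permutes {..<n}" "l' = permute_list p l"
      using mset_eq_permutation [of l' l] by (metis (mono_tags, lifting) index_lists_def mem_Collect_eq)
    \<comment> \<open>The sign of \<open>p\<close> appears once from the columns of \<open>A\<close>
      and once from the rows of \<open>B\<close>.\<close>
    have "minor n A I l' * minor n B l' J = (signof p * signof p) * (minor n A I l * minor n B l J)"
      unfolding p(2) using p(1) l A I by (simp add: minor_permute_cols minor_permute_rows index_lists_def)
    then show "minor n A I l * minor n B l J = minor n A I l' * minor n B l' J"
      by (simp only: signof_square mult_1)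
  qed (auto simp: minor_nondistinct_rows index_lists_def)
  then show ?thesis using fact_mult_minor_mult [OF assms] by simp
qed

subsection \<open>Newton's identities for exterior powers\<close>

text \<open>Laplace expansion along the first row. Deleting column b + 1 leaves the rows
  \<open>I\<close>; moving row b of these to the front costs (-1)^b against the Laplace sign
  (-1)^(b+1). All terms then carry the same minus sign, and the row list and the column list share
  their tail, so each term is again a bordered minor.\<close>

lemma minor_Cons_expand:
  assumes I: "length I = Suc n"
  shows "minor (Suc (Suc n)) A (i # I) (j # I)
       = A $$ (i, j) * minor (Suc n) A I I
         - (\<Sum>b<Suc n. A $$ (i, I ! b) *
             minor (Suc n) A (I ! b # take b I @ drop (Suc b) I) (j # take b I @ drop (Suc b) I))"
proof -
  let ?N = "Suc (Suc n)"
  let ?del = "\<lambda>b. take b I @ drop (Suc b) I"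
  define M where "M = mat ?N ?N (\<lambda>(a, b). A $$ ((i # I) ! a, (j # I) ! b))"
  have M: "M \<in> carrier_mat ?N ?N" by (simp add: M_def)
  have entry: "M $$ (0, 0) = A $$ (i, j)" "\<And>b. b < Suc n \<Longrightarrow> M $$ (0, Suc b) = A $$ (i, I ! b)"
    by (simp_all add: M_def)
  have c0: "cofactor M 0 0 = minor (Suc n) A I I"
  proof -
    have "mat_delete M 0 0 = mat (Suc n) (Suc n) (\<lambda>(a, b). A $$ (I ! a, I ! b))"
      by (intro eq_matI) (auto simp: mat_delete_def M_def)
    then show ?thesis by (simp add: cofactor_def minor_def)
  qed
  have c: "cofactor M 0 (Suc b) = - minor (Suc n) A (I ! b # ?del b) (j # ?del b)" if b: "b < Suc n" for b
  proof -
    let ?C = "mat_delete M 0 (Suc b)"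
    have C: "?C \<in> carrier_mat (Suc n) (Suc n)" using mat_delete_carrier [OF M] by simp
    have del_nth: "?del b ! a = (if a < b then I ! a else I ! Suc a)" if "a < n" for a
      using that b I by (auto simp: nth_append min_def)
    have C_entry: "?C $$ (a, e) = A $$ (I ! a, (j # ?del b) ! e)" if "a < Suc n" "e < Suc n" for a e
      using that b M by (auto simp: mat_delete_def M_def del_nth nth_Cons split: nat.splits)
    have "swap_row_to_front ?C b
        = mat (Suc n) (Suc n) (\<lambda>(a, e). A $$ ((I ! b # ?del b) ! a, (j # ?del b) ! e))"
      unfolding swap_row_to_front_result [OF C b]
      using b by (intro eq_matI) (auto simp: C_entry del_nth nth_Cons' not_le)
    then have "minor (Suc n) A (I ! b # ?del b) (j # ?del b) = (-1) ^ b * det ?C"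
      unfolding minor_def using swap_row_to_front_det [OF C b] by simp
    then show ?thesis by (simp add: cofactor_def)
  qed
  have "minor ?N A (i # I) (j # I) = det M"
    by (simp add: minor_def M_def)
  also have "\<dots> = (\<Sum>b<?N. M $$ (0, b) * cofactor M 0 b)"
    by (rule laplace_expansion_row [OF M]) simp
  also have "\<dots> = M $$ (0, 0) * cofactor M 0 0 + (\<Sum>b<Suc n. M $$ (0, Suc b) * cofactor M 0 (Suc b))"
    by (rule sum.lessThan_Suc_shift)
  also have "(\<Sum>b<Suc n. M $$ (0, Suc b) * cofactor M 0 (Suc b))
      = (\<Sum>b<Suc n. A $$ (i, I ! b) * - minor (Suc n) A (I ! b # ?del b) (j # ?del b))"
    by (intro sum.cong) (simp_all only: entry c lessThan_iff)
  finally show ?thesis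
    by (simp only: entry c0 mult_minus_right sum_negf) simp
qed

text \<open>The entries of the adjugate-type matrices in the classical proof of Newton's identities,
  scaled so that the sum runs over all index lists and no ordering of indices is involved.\<close>

definition bordered_sum :: "nat \<Rightarrow> 'a::comm_ring_1 mat \<Rightarrow> nat \<Rightarrow> nat \<Rightarrow> 'a" where
  "bordered_sum n A i j = (\<Sum>l\<in>index_lists n (dim_row A). minor (Suc n) A (i # l) (j # l))"

text \<open>For square \<open>A\<close> this is n! times the coefficient of t^n in det (1 + t
  A).\<close>

definition principal_sum :: "nat \<Rightarrow> 'a::comm_ring_1 mat \<Rightarrow> 'a" where
  "principal_sum n A = (\<Sum>l\<in>index_lists n (dim_row A). minor n A l l)"

lemma principal_sum_0: "principal_sum 0 A = 1"
  by (simp add: principal_sum_def minor_def)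

lemma principal_sum_Suc: "principal_sum (Suc n) A = (\<Sum>i<dim_row A. bordered_sum n A i i)"
  by (simp add: principal_sum_def bordered_sum_def sum_index_lists_Suc)

lemma bordered_sum_0: "bordered_sum 0 A i j = A $$ (i, j)"
  by (simp add: bordered_sum_def minor_def det_single)

text \<open>With b_n for the matrix of bordered sums divided by n! and e_n for the principal sum
  divided by n!, this is b_(n+1) = e_(n+1) A - A b_n, the Faddeev-LeVerrier recursion up to signs
  and a factor \<open>A\<close>.\<close>

lemma bordered_sum_Suc:
  "bordered_sum (Suc n) A i j = A $$ (i, j) * principal_sum (Suc n) A
     - of_nat (Suc n) * (\<Sum>m<dim_row A. A $$ (i, m) * bordered_sum n A m j)"
proof -
  let ?L = "index_lists (Suc n) (dim_row A)"
  let ?g = "\<lambda>m l. A $$ (i, m) * minor (Suc n) A (m # l) (j # l)"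
  have "bordered_sum (Suc n) A i j = (\<Sum>l\<in>?L. A $$ (i, j) * minor (Suc n) A l l
      - (\<Sum>b<Suc n. ?g (l ! b) (take b l @ drop (Suc b) l)))"
    unfolding bordered_sum_def
    by (intro sum.cong refl minor_Cons_expand) (simp add: index_lists_def)
  also have "\<dots> = A $$ (i, j) * principal_sum (Suc n) A
      - (\<Sum>l\<in>?L. \<Sum>b<Suc n. ?g (l ! b) (take b l @ drop (Suc b) l))"
    by (simp only: sum_subtractf principal_sum_def sum_distrib_left)
  also have "(\<Sum>l\<in>?L. \<Sum>b<Suc n. ?g (l ! b) (take b l @ drop (Suc b) l))
      = (\<Sum>b<Suc n. \<Sum>l\<in>?L. ?g (l ! b) (take b l @ drop (Suc b) l))"
    by (rule sum.swap)
  also have "\<dots> = (\<Sum>b<Suc n. \<Sum>m<dim_row A. \<Sum>l\<in>index_lists n (dim_row A). ?g m l)"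
    by (intro sum.cong refl sum_index_lists_remove_nth [where f = ?g]) simp
  also have "\<dots> = of_nat (Suc n) * (\<Sum>m<dim_row A. A $$ (i, m) * bordered_sum n A m j)"
    by (simp only: sum_constant card_lessThan bordered_sum_def sum_distrib_left)
  finally show ?thesis .
qed

text \<open>Matrix powers are defined by multiplication on the right, whereas the recursion above
  multiplies by \<open>A\<close> on the left.\<close>

lemma pow_mat_Suc_left: "A \<in> carrier_mat d d \<Longrightarrow> A ^\<^sub>m Suc k = A * A ^\<^sub>m k"
  by (induction k) (auto simp: assoc_mult_mat [of _ d d _ d _ d])

text \<open>The recursion unrolled. Newton's identities are its trace: summing the left side over i
  = j gives principal_sum (n+1) / n!, which is n + 1 times the trace of the exterior power of degree
  n + 1.\<close>

lemma bordered_sum_expand: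
  fixes A :: "'a::field_char_0 mat"
  assumes A: "A \<in> carrier_mat d d" and ij: "i < d" "j < d"
  shows "bordered_sum n A i j / fact n
       = (\<Sum>k\<le>n. (-1) ^ k * (A ^\<^sub>m Suc k) $$ (i, j) * (principal_sum (n - k) A / fact (n - k)))"
  using ij
proof (induction n arbitrary: i j)
  case 0
  then show ?case using A by (simp add: bordered_sum_0 principal_sum_0)
next
  case (Suc n)
  let ?e = "\<lambda>n. principal_sum n A / fact n"
  have pow: "(A ^\<^sub>m Suc (Suc k)) $$ (i, j) = (\<Sum>m<d. A $$ (i, m) * (A ^\<^sub>m Suc k) $$ (m, j))" for k
  proof -
    have "A ^\<^sub>m Suc (Suc k) = A * A ^\<^sub>m Suc k"
      by (rule pow_mat_Suc_left [OF A])
    moreover have "A ^\<^sub>m Suc k \<in> carrier_mat d d" using A by (rule pow_carrier_mat)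
    ultimately show ?thesis using A Suc.prems
      by (simp add: scalar_prod_def atLeast0LessThan del: pow_mat.simps)
  qed
  have "bordered_sum (Suc n) A i j / fact (Suc n)
      = A $$ (i, j) * ?e (Suc n) - (\<Sum>m<d. A $$ (i, m) * (bordered_sum n A m j / fact n))"
  proof -
    have "(a * P - of_nat (Suc n) * S) / fact (Suc n) = a * (P / fact (Suc n)) - S / fact n" for a P S :: 'a
      by (simp add: diff_divide_distrib del: of_nat_Suc)
    then show ?thesis using A by (simp add: bordered_sum_Suc sum_divide_distrib del: of_nat_Suc fact_Suc)
  qed
  also have "(\<Sum>m<d. A $$ (i, m) * (bordered_sum n A m j / fact n))
      = (\<Sum>m<d. \<Sum>k\<le>n. (-1) ^ k * (A $$ (i, m) * (A ^\<^sub>m Suc k) $$ (m, j)) * ?e (n - k))"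
    using Suc by (simp add: sum_distrib_left algebra_simps del: pow_mat.simps)
  also have "\<dots> = (\<Sum>k\<le>n. (-1) ^ k * (A ^\<^sub>m Suc (Suc k)) $$ (i, j) * ?e (n - k))"
    unfolding pow by (subst sum.swap) (simp add: sum_distrib_left sum_distrib_right
        sum_divide_distrib del: pow_mat.simps)
  finally show ?case
    using A Suc.prems by (simp add: sum.atMost_Suc_shift sum_negf del: sum.atMost_Suc)
qed

text \<open>The diagonal entries are the principal minors on increasing lists. Reordering a list
  permutes rows and columns alike, so the signs cancel and all n! orderings contribute
  equally.\<close>

lemma trace_exterior_power_mat:
  fixes A :: "'a::field_char_0 mat"
  assumes A: "A \<in> carrier_mat d d"
  shows "mat_trace (exterior_power_mat n A) = principal_sum n A / fact n"
proof -
  let ?B = "exterior_basis n d"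
  have "mat_trace (exterior_power_mat n A) = (\<Sum>i<length ?B. minor n A (?B ! i) (?B ! i))"
    using A by (simp add: mat_trace_def exterior_power_mat_def minor_def Let_def)
  also have "\<dots> = (\<Sum>l\<in>set ?B. minor n A l l)"
    using sum.reindex_bij_betw [OF bij_betw_nth [OF distinct_exterior_basis refl refl],
        of "\<lambda>l. minor n A l l" n d] by simp
  also have "fact n * \<dots> = (\<Sum>l\<in>index_lists n d. minor n A l l)"
  proof (rule sum_index_lists_eq_sum_exterior_basis [symmetric])
    fix l l' :: "nat list" assume l: "l \<in> index_lists n d" and "mset l = mset l'"
    then obtain p where p: "p permutes {..<n}" "l' = permute_list p l"
      using mset_eq_permutation [of l' l] by (metis (mono_tags, lifting) index_lists_def mem_Collect_eq)
    have "minor n A l' l' = (signof p * signof p) * minor n A l l"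
      unfolding p(2) using p(1) l A permute_index_lists [OF p(1) l]
      by (simp add: minor_permute_cols) (simp add: minor_permute_rows index_lists_def)
    then show "minor n A l l = minor n A l' l'"
      by (simp only: signof_square mult_1)
  qed (auto simp: minor_nondistinct_rows index_lists_def)
  finally show ?thesis using A by (simp add: principal_sum_def field_simps)
qed

theorem Newton_identity_exterior_power:
  fixes A :: "'a::field_char_0 mat"
  assumes A: "A \<in> carrier_mat d d"
  shows "of_nat (Suc n) * mat_trace (exterior_power_mat (Suc n) A)
       = (\<Sum>k\<le>n. (-1) ^ k * mat_trace (A ^\<^sub>m Suc k) * mat_trace (exterior_power_mat (n - k) A))"
proof -
  have tr: "mat_trace (A ^\<^sub>m Suc k) = (\<Sum>i<d. (A ^\<^sub>m Suc k) $$ (i, i))" for k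
    using A by (simp add: mat_trace_def del: pow_mat.simps)
  have "of_nat (Suc n) * mat_trace (exterior_power_mat (Suc n) A) = principal_sum (Suc n) A / fact n"
    by (simp add: trace_exterior_power_mat [OF A] del: of_nat_Suc)
  also have "\<dots> = (\<Sum>i<d. bordered_sum n A i i / fact n)"
    using A by (simp add: principal_sum_Suc sum_divide_distrib)
  also have "\<dots> = (\<Sum>i<d. \<Sum>k\<le>n. (-1) ^ k * (A ^\<^sub>m Suc k) $$ (i, i) * (principal_sum (n - k) A / fact (n - k)))"
    by (intro sum.cong refl bordered_sum_expand [OF A]) auto
  also have "\<dots> = (\<Sum>k\<le>n. (-1) ^ k * mat_trace (A ^\<^sub>m Suc k) * mat_trace (exterior_power_mat (n - k) A))"
    by (subst sum.swap) (simp add: trace_exterior_power_mat [OF A] tr sum_distrib_left sum_distrib_right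
        sum_divide_distrib del: pow_mat.simps)
  finally show ?thesis .
qed

text \<open>\<open>elem_of_power_sums p n\<close> is the value of the \<open>n\<close>-th elementary symmetric function
  when the power sums are \<open>p 1\<close>, \<open>p 2\<close>, and so on (\<open>p 0\<close> is ignored).\<close>

fun elem_of_power_sums :: "(nat \<Rightarrow> 'a::field_char_0) \<Rightarrow> nat \<Rightarrow> 'a" where
  "elem_of_power_sums p 0 = 1"
| "elem_of_power_sums p (Suc n)
     = (\<Sum>k\<le>n. (-1) ^ k * p (Suc k) * elem_of_power_sums p (n - k)) / of_nat (Suc n)"

declare elem_of_power_sums.simps(2) [simp del]

text \<open>The recursion determines e (n+1) because n + 1 is invertible. It identifies both the
  traces of exterior powers and the coefficients of a product of two generating series.\<close>

lemma elem_of_power_sums_unique: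
  assumes "e 0 = 1"
    and "\<And>n. of_nat (Suc n) * e (Suc n) = (\<Sum>k\<le>n. (-1) ^ k * p (Suc k) * e (n - k))"
  shows "e n = elem_of_power_sums p n"
proof (induction n rule: less_induct)
  case (less n)
  show ?case
  proof (cases n)
    case (Suc m)
    have "of_nat (Suc m) * e (Suc m) = (\<Sum>k\<le>m. (-1) ^ k * p (Suc k) * elem_of_power_sums p (m - k))"
      unfolding assms(2) using less Suc by (intro sum.cong) auto
    also have "\<dots> = of_nat (Suc m) * elem_of_power_sums p (Suc m)"
      by (simp add: elem_of_power_sums.simps(2) del: of_nat_Suc)
    finally show ?thesis using Suc by (simp del: of_nat_Suc)
  qed (simp add: assms)
qed

text \<open>The generating series \<open>E\<close> satisfies \<open>E' = E P\<close> with \<open>P\<close> linear in the power sums,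
  so \<open>E\<close> turns sums into products.\<close>

lemma elem_of_power_sums_add:
  "elem_of_power_sums (\<lambda>k. p k + q k) n
     = (\<Sum>i\<le>n. elem_of_power_sums p i * elem_of_power_sums q (n - i))"
proof -
  define E where "E p = Abs_fps (elem_of_power_sums p)" for p :: "nat \<Rightarrow> 'a"
  define P where "P p = Abs_fps (\<lambda>k. (-1) ^ k * p (Suc k))" for p :: "nat \<Rightarrow> 'a"
  have deriv: "fps_deriv (E p) = P p * E p" for p
    by (rule fps_ext)
      (simp add: E_def P_def fps_mult_nth elem_of_power_sums.simps(2) atLeast0AtMost del: of_nat_Suc)
  have P: "P p + P q = P (\<lambda>k. p k + q k)"
    by (rule fps_ext) (simp add: P_def algebra_simps)
  have ode: "fps_deriv (E p * E q) = P (\<lambda>k. p k + q k) * (E p * E q)"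
    unfolding P [symmetric] by (simp add: deriv algebra_simps)
  have "of_nat (Suc n) * fps_nth (E p * E q) (Suc n)
      = (\<Sum>k\<le>n. (-1) ^ k * (p (Suc k) + q (Suc k)) * fps_nth (E p * E q) (n - k))" for n
  proof -
    have "of_nat (Suc n) * fps_nth (E p * E q) (Suc n) = fps_nth (fps_deriv (E p * E q)) n"
      by (simp only: fps_deriv_nth Suc_eq_plus1)
    also have "\<dots> = (\<Sum>k\<le>n. fps_nth (P (\<lambda>k. p k + q k)) k * fps_nth (E p * E q) (n - k))"
      unfolding ode fps_mult_nth [of "P _"] by (simp only: atLeast0AtMost)
    finally show ?thesis by (simp add: P_def)
  qed
  then have "fps_nth (E p * E q) n = elem_of_power_sums (\<lambda>k. p k + q k) n"
    by (intro elem_of_power_sums_unique) (simp_all add: E_def)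
  then show ?thesis
    by (simp add: E_def fps_mult_nth atLeast0AtMost)
qed

lemma trace_exterior_power_eq_elem:
  assumes "A \<in> carrier_mat d d"
  shows "mat_trace (exterior_power_mat n A) = elem_of_power_sums (\<lambda>k. mat_trace (A ^\<^sub>m k)) n"
proof (rule elem_of_power_sums_unique)
  show "mat_trace (exterior_power_mat 0 A) = 1"
    by (simp add: trace_exterior_power_mat [OF assms] principal_sum_0)
qed (rule Newton_identity_exterior_power [OF assms])

subsection \<open>Kronecker products and exterior powers of matrices\<close>

lemma mat_trace_carrier: "A \<in> carrier_mat d d \<Longrightarrow> mat_trace A = (\<Sum>i<d. A $$ (i, i))"
  by (auto simp: mat_trace_def)

lemma mat_trace_four_block_mat:
  assumes "A \<in> carrier_mat m m" "D \<in> carrier_mat n n"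
  shows "mat_trace (four_block_mat A B C D) = mat_trace A + mat_trace D"
proof -
  let ?M = "four_block_mat A B C D"
  have "mat_trace ?M = (\<Sum>i<m + n. ?M $$ (i, i))"
    using assms by (simp add: mat_trace_def)
  also have "\<dots> = (\<Sum>i<m. ?M $$ (i, i)) + (\<Sum>i<n. ?M $$ (m + i, m + i))"
    by (induction n) (simp_all add: add.assoc)
  finally show ?thesis using assms by (simp add: mat_trace_carrier)
qed

lemma sum_lessThan_mult_div_mod:
  fixes f :: "nat \<Rightarrow> nat \<Rightarrow> 'a::comm_monoid_add"
  shows "(\<Sum>i<m * n. f (i div n) (i mod n)) = (\<Sum>j<m. \<Sum>k<n. f j k)"
proof -
  have bound: "j * n + k < m * n" if "j < m" "k < n" for j k
  proof -
    have "j * n + k < Suc j * n" using that by simp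
    also have "\<dots> \<le> m * n" using that by (intro mult_le_mono1) simp
    finally show ?thesis .
  qed
  have "(\<Sum>i<m * n. f (i div n) (i mod n)) = (\<Sum>(j, k)\<in>{..<m} \<times> {..<n}. f j k)"
    by (rule sum.reindex_bij_witness [where i = "\<lambda>(j, k). j * n + k" and j = "\<lambda>i. (i div n, i mod n)"])
      (auto simp: less_mult_imp_div_less bound intro!: mod_less_divisor gr0I)
  then show ?thesis by (simp add: sum.cartesian_product)
qed

lemma kronecker_carrier:
  "A \<in> carrier_mat m m \<Longrightarrow> B \<in> carrier_mat n n \<Longrightarrow> kronecker A B \<in> carrier_mat (m * n) (m * n)"
  by (auto simp: kronecker_def)

lemma kronecker_mult:
  assumes "A \<in> carrier_mat m m" "A' \<in> carrier_mat m m" "B \<in> carrier_mat n n" "B' \<in> carrier_mat n n"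
  shows "kronecker (A * A') (B * B') = kronecker A B * kronecker A' B'"
proof (rule eq_matI)
  fix i j assume "i < dim_row (kronecker A B * kronecker A' B')" "j < dim_col (kronecker A B * kronecker A' B')"
  then have ij: "i < m * n" "j < m * n" using assms by (auto simp: kronecker_def)
  then have n: "0 < n" by (cases n) auto
  have ij': "i div n < m" "j div n < m" "i mod n < n" "j mod n < n"
    using ij n by (auto simp: less_mult_imp_div_less)
  have "(kronecker A B * kronecker A' B') $$ (i, j)
      = (\<Sum>k<m * n. (A $$ (i div n, k div n) * B $$ (i mod n, k mod n))
          * (A' $$ (k div n, j div n) * B' $$ (k mod n, j mod n)))"
    using assms ij by (simp add: kronecker_def scalar_prod_def atLeast0LessThan)
  also have "\<dots> = (\<Sum>k<m. \<Sum>l<n. (A $$ (i div n, k) * B $$ (i mod n, l)) * (A' $$ (k, j div n) * B' $$ (l, j mod n)))"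
    by (rule sum_lessThan_mult_div_mod)
  also have "\<dots> = (A * A') $$ (i div n, j div n) * (B * B') $$ (i mod n, j mod n)"
    using assms ij' by (simp add: scalar_prod_def atLeast0LessThan sum_product algebra_simps)
  finally show "kronecker (A * A') (B * B') $$ (i, j) = (kronecker A B * kronecker A' B') $$ (i, j)"
    using assms ij by (simp add: kronecker_def)
qed (use assms in \<open>auto simp: kronecker_def\<close>)

lemma kronecker_one: "kronecker (1\<^sub>m m) (1\<^sub>m n) = 1\<^sub>m (m * n)"
proof (rule eq_matI)
  fix i j assume "i < dim_row (1\<^sub>m (m * n))" "j < dim_col (1\<^sub>m (m * n))"
  then have ij: "i < m * n" "j < m * n" by auto
  then have "0 < n" by (cases n) auto
  then have "i div n < m" "j div n < m" "i mod n < n" "j mod n < n"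
    using ij by (auto simp: less_mult_imp_div_less)
  moreover have "i = j \<longleftrightarrow> i div n = j div n \<and> i mod n = j mod n"
    by (metis div_mult_mod_eq)
  ultimately show "kronecker (1\<^sub>m m) (1\<^sub>m n) $$ (i, j) = (1\<^sub>m (m * n) :: 'a mat) $$ (i, j)"
    using ij by (simp add: kronecker_def)
qed (auto simp: kronecker_def)

section \<open>Functoriality of exterior power matrices\<close>

lemma exterior_power_mat_index:
  assumes "A \<in> carrier_mat d d" "i < length (exterior_basis n d)" "j < length (exterior_basis n d)"
  shows "exterior_power_mat n A $$ (i, j) = minor n A (exterior_basis n d ! i) (exterior_basis n d ! j)"
  using assms by (simp add: exterior_power_mat_def minor_def Let_def)

lemma exterior_power_mat_carrier:
  assumes "A \<in> carrier_mat d d"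
  shows "exterior_power_mat n A \<in> carrier_mat (length (exterior_basis n d)) (length (exterior_basis n d))"
  using assms by (simp add: exterior_power_mat_def Let_def)

lemma nth_exterior_basis: "i < length (exterior_basis n d) \<Longrightarrow> exterior_basis n d ! i \<in> index_lists n d"
  using nth_mem in_exterior_basis_iff by blast

lemma exterior_power_mat_mult:
  fixes A B :: "'a::field_char_0 mat"
  assumes A: "A \<in> carrier_mat d d" and B: "B \<in> carrier_mat d d"
  shows "exterior_power_mat n (A * B) = exterior_power_mat n A * exterior_power_mat n B"
proof (rule eq_matI)
  let ?B = "exterior_basis n d"
  note carr = exterior_power_mat_carrier [OF A, of n] exterior_power_mat_carrier [OF B, of n]
  have AB: "A * B \<in> carrier_mat d d" using A B by simp
  fix i j assume "i < dim_row (exterior_power_mat n A * exterior_power_mat n B)"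
    "j < dim_col (exterior_power_mat n A * exterior_power_mat n B)"
  then have ij: "i < length ?B" "j < length ?B" using carr by auto
  have "exterior_power_mat n (A * B) $$ (i, j)
      = (\<Sum>l\<in>set ?B. minor n A (?B ! i) l * minor n B l (?B ! j))"
    using ij by (simp add: exterior_power_mat_index [OF AB] Cauchy_Binet [OF A B] nth_exterior_basis)
  also have "\<dots> = (\<Sum>k<length ?B. minor n A (?B ! i) (?B ! k) * minor n B (?B ! k) (?B ! j))"
    by (rule sum.reindex_bij_betw [OF bij_betw_nth [OF distinct_exterior_basis refl refl], symmetric])
  also have "\<dots> = (exterior_power_mat n A * exterior_power_mat n B) $$ (i, j)"
    using ij carr by (simp add: scalar_prod_def exterior_power_mat_index [OF A]
        exterior_power_mat_index [OF B] atLeast0LessThan)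
  finally show "exterior_power_mat n (A * B) $$ (i, j)
      = (exterior_power_mat n A * exterior_power_mat n B) $$ (i, j)" .
qed (use exterior_power_mat_carrier [of "A * B" d n] exterior_power_mat_carrier [OF A, of n]
      exterior_power_mat_carrier [OF B, of n] A B in auto)

text \<open>Two different increasing lists of equal length have different sets of entries. Some row
  index is then missing among the columns, and that row kills every Leibniz term.\<close>

lemma minor_one:
  assumes "K \<in> set (exterior_basis n d)" "L \<in> set (exterior_basis n d)"
  shows "minor n (1\<^sub>m d) K L = (if K = L then 1 else 0)"
proof (cases "K = L")
  case True
  have K: "K \<in> index_lists n d" "distinct K" using assms by (auto simp: in_exterior_basis_iff)
  then have "mat n n (\<lambda>(a, b). 1\<^sub>m d $$ (K ! a, K ! b)) = (1\<^sub>m n :: 'a mat)"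
    by (intro eq_matI) (auto simp: nth_index_lists nth_eq_iff_index_eq index_lists_def)
  then show ?thesis using True by (simp add: minor_def)
next
  case False
  have KL: "K \<in> index_lists n d" "sorted K" "distinct K" "L \<in> index_lists n d" "sorted L" "distinct L"
    using assms by (auto simp: in_exterior_basis_iff)
  have "\<not> set K \<subseteq> set L"
  proof
    assume "set K \<subseteq> set L"
    moreover have "card (set K) = card (set L)"
      using KL by (simp add: distinct_card index_lists_def)
    ultimately have "set K = set L" by (intro card_subset_eq) auto
    then show False using KL False by (metis sorted_distinct_set_unique)
  qed
  then obtain x where "x \<in> set K" "x \<notin> set L" by blast
  then obtain a where a: "a < n" "K ! a \<notin> set L"
    using KL by (auto simp: in_set_conv_nth [of x K] index_lists_def)
  have "(\<Prod>a<n. (1\<^sub>m d :: 'a mat) $$ (K ! a, L ! p a)) = 0" if p: "p permutes {..<n}" for p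
  proof (rule prod_zero)
    have "p a < n" using permutes_in_image [OF p, of a] a by simp
    then show "\<exists>a\<in>{..<n}. (1\<^sub>m d :: 'a mat) $$ (K ! a, L ! p a) = 0"
      using a KL by (intro bexI [of _ a]) (auto simp: nth_index_lists index_lists_def)
  qed simp
  then show ?thesis using False by (simp add: minor_Leibniz)
qed

lemma exterior_power_mat_one:
  "exterior_power_mat n (1\<^sub>m d) = 1\<^sub>m (length (exterior_basis n d))"
proof (rule eq_matI)
  fix i j assume "i < dim_row (1\<^sub>m (length (exterior_basis n d)))" "j < dim_col (1\<^sub>m (length (exterior_basis n d)))"
  then show "exterior_power_mat n (1\<^sub>m d) $$ (i, j) = (1\<^sub>m (length (exterior_basis n d)) :: 'a mat) $$ (i, j)"
    by (simp add: exterior_power_mat_index [of _ d] minor_one nth_eq_iff_index_eq)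
qed (auto simp: exterior_power_mat_def Let_def)

subsection \<open>Characters of representations\<close>

text \<open>The characters of actual representations, that of the zero module included. Closure
  under sums, products and exterior powers is seen on matrices here and then carried over to
  differences.\<close>

definition rep_characters :: "('g, 'b) monoid_scheme \<Rightarrow> ('g \<Rightarrow> 'k::field_char_0) set" where
  "rep_characters G = {character G \<rho> | d \<rho>. representation G d \<rho>}"

lemma rep_charactersI: "representation G d \<rho> \<Longrightarrow> character G \<rho> \<in> rep_characters G"
  by (auto simp: rep_characters_def)

lemma representation_carrier: "representation G d \<rho> \<Longrightarrow> g \<in> carrier G \<Longrightarrow> \<rho> g \<in> carrier_mat d d"
  by (simp add: representation_def)

lemma representation_trivial: "representation G d (\<lambda>g. 1\<^sub>m d)"
  by (simp add: representation_def)

lemma character_trivial: "character G (\<lambda>g. 1\<^sub>m d) = (\<lambda>g. if g \<in> carrier G then of_nat d else 0)"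
  by (rule ext) (simp add: character_def mat_trace_def)

lemma rep_characters_const: "(\<lambda>g. if g \<in> carrier G then of_nat d else 0) \<in> rep_characters G"
  unfolding character_trivial [symmetric] by (rule rep_charactersI) (rule representation_trivial)

lemma rep_characters_0: "(\<lambda>g. 0) \<in> rep_characters G"
  using rep_characters_const [of G 0] by (simp cong: if_cong)

lemma rep_characters_add:
  assumes "x \<in> rep_characters G" "y \<in> rep_characters G"
  shows "(\<lambda>g. x g + y g) \<in> rep_characters G"
proof -
  obtain m \<rho> n \<sigma> where \<rho>: "representation G m \<rho>" "x = character G \<rho>"
    and \<sigma>: "representation G n \<sigma>" "y = character G \<sigma>"
    using assms by (auto simp: rep_characters_def)
  let ?\<tau> = "\<lambda>g. four_block_mat (\<rho> g) (0\<^sub>m m n) (0\<^sub>m n m) (\<sigma> g)"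
  have "representation G (m + n) ?\<tau>"
    unfolding representation_def
  proof (intro conjI ballI)
    fix g h assume gh: "g \<in> carrier G" "h \<in> carrier G"
    note carr = gh [THEN representation_carrier [OF \<rho>(1)]] gh [THEN representation_carrier [OF \<sigma>(1)]]
    have "?\<tau> g * ?\<tau> h = four_block_mat (\<rho> g * \<rho> h) (0\<^sub>m m n) (0\<^sub>m n m) (\<sigma> g * \<sigma> h)"
      using carr by (subst mult_four_block_mat [of _ m m _ n _ n _ _ m _ n]) auto
    then show "?\<tau> (g \<otimes>\<^bsub>G\<^esub> h) = ?\<tau> g * ?\<tau> h"
      using \<rho> \<sigma> gh by (simp add: representation_def)
  qed (use \<rho> \<sigma> in \<open>auto simp: representation_def four_block_one_mat\<close>)
  moreover have "character G ?\<tau> = (\<lambda>g. x g + y g)"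
    using \<rho> \<sigma> by (intro ext) (auto simp: character_def representation_def mat_trace_four_block_mat [of _ m _ n])
  ultimately show ?thesis by (metis rep_charactersI)
qed

lemma rep_characters_mult:
  assumes "x \<in> rep_characters G" "y \<in> rep_characters G"
  shows "(\<lambda>g. x g * y g) \<in> rep_characters G"
proof -
  obtain m \<rho> n \<sigma> where \<rho>: "representation G m \<rho>" "x = character G \<rho>"
    and \<sigma>: "representation G n \<sigma>" "y = character G \<sigma>"
    using assms by (auto simp: rep_characters_def)
  have "representation G (m * n) (\<lambda>g. kronecker (\<rho> g) (\<sigma> g))"
    using \<rho> \<sigma> unfolding representation_def
    by (auto simp: kronecker_mult [of _ m _ _ n] kronecker_one kronecker_carrier)
  moreover have "character G (\<lambda>g. kronecker (\<rho> g) (\<sigma> g)) = (\<lambda>g. x g * y g)"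
    using character_tensor [OF \<rho>(1) \<sigma>(1)] \<rho> \<sigma> by (simp add: character_ring_def)
  ultimately show ?thesis by (metis rep_charactersI)
qed

lemma representation_exterior_power:
  fixes \<rho> :: "'g \<Rightarrow> 'k::field_char_0 mat"
  assumes "representation G d \<rho>"
  shows "representation G (length (exterior_basis n d)) (\<lambda>g. exterior_power_mat n (\<rho> g))"
  using assms unfolding representation_def
  by (auto simp: exterior_power_mat_one exterior_power_mat_carrier
      exterior_power_mat_mult [where d = d])

lemma representation_pow:
  assumes "group G" "representation G d \<rho>" "g \<in> carrier G"
  shows "\<rho> (g [^]\<^bsub>G\<^esub> (k::nat)) = \<rho> g ^\<^sub>m k"
proof -
  interpret group G by fact
  show ?thesis
    using assms(2,3) by (induction k) (auto simp: representation_def)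
qed

text \<open>Since \<rho>(g)^k = \<rho>(g^k), the traces of the powers of \<rho>(g) are values of the
  character. The right-hand side thus no longer mentions \<rho> and makes sense for virtual
  characters.\<close>

lemma character_exterior_power:
  fixes \<rho> :: "'g \<Rightarrow> 'k::field_char_0 mat"
  assumes "group G" "representation G d \<rho>" "g \<in> carrier G"
  shows "character G (\<lambda>g. exterior_power_mat n (\<rho> g)) g
       = elem_of_power_sums (\<lambda>k. character G \<rho> (g [^]\<^bsub>G\<^esub> k)) n"
proof -
  interpret group G by fact
  show ?thesis
    using assms(3) trace_exterior_power_eq_elem [OF representation_carrier [OF assms(2,3)], of n]
    by (simp add: character_def representation_pow [OF assms])
qed

text \<open>The trace of a permutation matrix counts fixed points, and left translation by g has
  none unless g is the identity, where it fixes all of the group.\<close>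

lemma rep_characters_regular:
  fixes G (structure)
  assumes "group G" "finite (carrier G)"
  shows "(\<lambda>g. if g = \<one>\<^bsub>G\<^esub> then of_nat (card (carrier G)) else 0) \<in> rep_characters G"
proof -
  interpret group G by fact
  define N where "N = card (carrier G)"
  obtain e where e: "bij_betw e {..<N} (carrier G)"
    using ex_bij_betw_nat_finite [OF assms(2)] unfolding N_def atLeast0LessThan by blast
  then have e_carr: "e i \<in> carrier G" if "i < N" for i
    using that by (auto simp: bij_betw_def)
  have e_inj: "e i = e j \<longleftrightarrow> i = j" if "i < N" "j < N" for i j
    using that e by (auto simp: bij_betw_def inj_on_def)
  define \<rho> :: "'a \<Rightarrow> 'c mat" where "\<rho> g = mat N N (\<lambda>(i, j). if e i = g \<otimes> e j then 1 else 0)" for g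
  have "representation G N \<rho>"
    unfolding representation_def
  proof (intro conjI ballI)
    fix g h assume gh: "g \<in> carrier G" "h \<in> carrier G"
    show "\<rho> (g \<otimes> h) = \<rho> g * \<rho> h"
    proof (rule eq_matI)
      fix i j assume "i < dim_row (\<rho> g * \<rho> h)" "j < dim_col (\<rho> g * \<rho> h)"
      then have ij: "i < N" "j < N" by (auto simp: \<rho>_def)
      have "h \<otimes> e j \<in> e ` {..<N}"
        using e gh e_carr [OF ij(2)] by (simp add: bij_betw_def)
      then obtain k where k: "k < N" "e k = h \<otimes> e j" by auto
      have "(\<rho> g * \<rho> h) $$ (i, j)
          = (\<Sum>l<N. (if e i = g \<otimes> e l then 1 else 0) * (if e l = h \<otimes> e j then 1 else 0))"
        using ij by (simp add: \<rho>_def scalar_prod_def atLeast0LessThan)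
      \<comment> \<open>Column \<open>j\<close> of \<open>\<rho> h\<close> has its only nonzero
        entry in row \<open>k\<close>.\<close>
      also have "\<dots> = (\<Sum>l<N. if l = k then (if e i = g \<otimes> e l then 1 else 0) else 0)"
        using k by (intro sum.cong) (auto simp: e_inj simp flip: k(2))
      also have "\<dots> = (if e i = g \<otimes> e k then 1 else 0)"
        using k by simp
      finally show "\<rho> (g \<otimes> h) $$ (i, j) = (\<rho> g * \<rho> h) $$ (i, j)"
        using ij gh k e_carr by (simp add: \<rho>_def m_assoc)
    qed (auto simp: \<rho>_def)
  next
    show "\<rho> \<one> = 1\<^sub>m N"
      by (rule eq_matI) (auto simp: \<rho>_def e_carr e_inj)
  qed (simp add: \<rho>_def)
  moreover have "character G \<rho> = (\<lambda>g. if g = \<one> then of_nat (card (carrier G)) else 0)"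
  proof
    fix g
    show "character G \<rho> g = (if g = \<one> then of_nat (card (carrier G)) else 0)"
    proof (cases "g \<in> carrier G")
      case True
      have "e i = g \<otimes> e i \<longleftrightarrow> g = \<one>" if "i < N" for i
        using True e_carr [OF that] by simp
      then have "character G \<rho> g = (\<Sum>i<N. if g = \<one> then 1 else 0)"
        using True by (simp add: character_def mat_trace_def \<rho>_def)
      then show ?thesis by (simp add: N_def)
    qed (auto simp: character_def)
  qed
  ultimately show ?thesis by (metis rep_charactersI)
qed

subsection \<open>Composition series\<close>

text \<open>A maximal independent subset of \<open>W\<close> spans \<open>W\<close>; enlarged to a
  maximal independent subset of the whole space it becomes a basis. A list records that the vectors
  from \<open>W\<close> come first, ready to be the columns of a matrix.\<close>

lemma (in vec_space) subspace_adapted_basis: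
  assumes W: "VectorSpace.subspace class_ring W V"
  obtains bs m where "length bs = n" "distinct bs" "set bs \<subseteq> carrier_vec n" "lin_indpt (set bs)"
    "m \<le> n" "set (take m bs) \<subseteq> W" "W \<subseteq> span (set (take m bs))"
proof -
  have W_carr: "W \<subseteq> carrier_vec n"
    using W by (auto simp: VectorSpace.subspace_def submodule_def)
  have bound: "finite A \<and> card A \<le> n" if "A \<subseteq> carrier_vec n" "lin_indpt A" for A
    using li_le_dim [of A] that by (simp add: dim_is_n)
  have "\<exists>A. finite A \<and> maximal A (\<lambda>A. A \<subseteq> W \<and> lin_indpt A)"
    by (rule maximal_exists [where B = "{}" and N = n])
      (use bound W_carr in \<open>auto simp: lin_dep_def\<close>)
  then obtain A where A: "finite A" "A \<subseteq> W" "lin_indpt A"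
    and A_max: "\<And>B. A \<subseteq> B \<Longrightarrow> B \<subseteq> W \<Longrightarrow> lin_indpt B \<Longrightarrow> B = A"
    unfolding maximal_def by metis
  have "\<exists>S. finite S \<and> maximal S (\<lambda>S. A \<subseteq> S \<and> S \<subseteq> carrier_vec n \<and> lin_indpt S)"
    by (rule maximal_exists [where B = A and N = n]) (use A bound W_carr in auto)
  then obtain S where S: "finite S" "A \<subseteq> S" "S \<subseteq> carrier_vec n" "lin_indpt S"
    and S_max: "\<And>B. S \<subseteq> B \<Longrightarrow> A \<subseteq> B \<Longrightarrow> B \<subseteq> carrier_vec n \<Longrightarrow> lin_indpt B \<Longrightarrow> B = S"
    unfolding maximal_def by metis
  have "maximal S (\<lambda>S. S \<subseteq> carrier_vec n \<and> lin_indpt S)"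
    unfolding maximal_def using S by (intro conjI impI allI S_max) auto
  then have "basis S" by (rule max_li_is_basis)
  then have "card S = n"
    using dim_basis [of S] S by (simp add: dim_is_n)
  obtain as where as: "set as = A" "distinct as"
    using finite_distinct_list [OF A(1)] by blast
  obtain cs where cs: "set cs = S - A" "distinct cs"
    using finite_distinct_list [of "S - A"] S by auto
  have "W \<subseteq> span A"
  proof
    fix w assume w: "w \<in> W"
    show "w \<in> span A"
    proof (cases "w \<in> A")
      case True
      then show ?thesis using A W_carr by (intro span_mem) auto
    next
      case False
      show ?thesis
      proof (rule ccontr)
        assume "w \<notin> span A"
        then have "lin_indpt (A \<union> {w})"
          using lin_dep_iff_in_span [of A w] A W_carr w False by auto
        then show False using A_max [of "A \<union> {w}"] w False A by auto
      qed
    qed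
  qed
  have len: "length (as @ cs) = n"
  proof -
    have "length (as @ cs) = card (set (as @ cs))"
      using as cs by (intro distinct_card [symmetric]) auto
    also have "set (as @ cs) = S" using as cs S by auto
    finally show ?thesis using \<open>card S = n\<close> by simp
  qed
  show ?thesis
  proof (rule that [of "as @ cs" "length as"])
    show "length as \<le> n" using len by simp
    have "set (as @ cs) = S" using as cs S by auto
    then show "set (as @ cs) \<subseteq> carrier_vec n" "lin_indpt (set (as @ cs))"
      using S by simp_all
    show "set (take (length as) (as @ cs)) \<subseteq> W" "W \<subseteq> span (set (take (length as) (as @ cs)))"
      using as A \<open>W \<subseteq> span A\<close> by simp_all
  qed (use as cs len in auto)
qed


lemma mat_trace_mult_comm:
  fixes A B :: "'a::comm_ring_1 mat"
  assumes "A \<in> carrier_mat n n" "B \<in> carrier_mat n n"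
  shows "mat_trace (A * B) = mat_trace (B * A)"
proof -
  have "mat_trace (A * B) = (\<Sum>i<n. \<Sum>j<n. A $$ (i, j) * B $$ (j, i))"
    using assms by (simp add: mat_trace_def scalar_prod_def atLeast0LessThan)
  also have "\<dots> = (\<Sum>j<n. \<Sum>i<n. B $$ (j, i) * A $$ (i, j))"
    by (subst sum.swap) (simp add: mult.commute)
  also have "\<dots> = mat_trace (B * A)"
    using assms by (simp add: mat_trace_def scalar_prod_def atLeast0LessThan)
  finally show ?thesis .
qed

text \<open>The columns of \<open>P\<close> form a basis adapted to \<open>W\<close>, so its inverse
  \<open>Q\<close> sends \<open>W\<close> into the span of the first \<open>m\<close> unit vectors.
  \<open>P\<close> depends on \<open>W\<close> only and therefore triangularises all matrices
  preserving \<open>W\<close> at once, as a representation requires. The two boundary cases of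
  \<open>m\<close> will show that both blocks are proper.\<close>

lemma invariant_subspace_block_triangular:
  fixes W :: "'a::field vec set"
  assumes W: "VectorSpace.subspace class_ring W (module_vec TYPE('a) n)"
  obtains P Q m where "P \<in> carrier_mat n n" "Q \<in> carrier_mat n n" "P * Q = 1\<^sub>m n" "Q * P = 1\<^sub>m n"
    "m \<le> n" "m = 0 \<Longrightarrow> W = {0\<^sub>v n}" "m = n \<Longrightarrow> W = carrier_vec n"
    "\<And>A i j. A \<in> carrier_mat n n \<Longrightarrow> (\<forall>w\<in>W. A *\<^sub>v w \<in> W) \<Longrightarrow> m \<le> i \<Longrightarrow> i < n \<Longrightarrow> j < m
       \<Longrightarrow> (Q * (A * P)) $$ (i, j) = 0"
proof -
  interpret vec_space "TYPE('a)" n .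
  obtain bs m where bs: "length bs = n" "distinct bs" "set bs \<subseteq> carrier_vec n" "lin_indpt (set bs)"
    and m: "m \<le> n" "set (take m bs) \<subseteq> W" "W \<subseteq> span (set (take m bs))"
    using subspace_adapted_basis [OF W] by blast
  have W': "submodule class_ring W V" "W \<subseteq> carrier_vec n" "0\<^sub>v n \<in> W"
    using W by (auto simp: VectorSpace.subspace_def submodule_def)
  define P where "P = mat_of_cols n bs"
  have P: "P \<in> carrier_mat n n" using bs by (auto simp: P_def)
  have cols_P: "cols P = bs" using bs by (simp add: P_def)
  have col_P: "col P j = bs ! j" if "j < n" for j
    using that bs cols_P P cols_nth [of j P] by simp
  have "det P \<noteq> 0"
    using det_rank_iff [OF P] lin_indpt_full_rank [OF P] bs cols_P by simp
  then have "P \<in> Units (ring_mat TYPE('a) n ())" by (rule det_non_zero_imp_unit [OF P])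
  then obtain Q where Q: "Q \<in> carrier_mat n n" "Q * P = 1\<^sub>m n" "P * Q = 1\<^sub>m n"
    by (auto simp: Units_def ring_mat_simps)
  have Q_basis: "(Q *\<^sub>v (bs ! k)) $ i = (if i = k then 1 else 0)" if "i < n" "k < n" for i k
  proof -
    have "Q *\<^sub>v (bs ! k) = col (Q * P) k"
      unfolding col_P [OF that(2), symmetric] using col_mult2 [OF Q(1) P that(2)] by simp
    then show ?thesis using that Q by simp
  qed
  have Q_W: "(Q *\<^sub>v w) $ i = 0" if w: "w \<in> W" and i: "m \<le> i" "i < n" for w i
  proof -
    let ?A = "set (take m bs)"
    have A: "?A \<subseteq> carrier_vec n" using m W' by blast
    obtain a where a: "w = lincomb a ?A"
      using finite_in_span [of ?A w] A m(3) w by auto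
    have "(Q *\<^sub>v b) $ i = 0" if b: "b \<in> ?A" for b
    proof -
      obtain k where "k < m" "b = bs ! k" using b m(1) bs(1) by (auto simp: in_set_conv_nth)
      then show ?thesis using Q_basis [of i k] i m(1) by simp
    qed
    then have zero: "b \<bullet> row Q i = 0" if "b \<in> ?A" for b
      using that i Q A comm_scalar_prod [of b n "row Q i"] by auto
    \<comment> \<open>As a scalar product with a fixed row, the coordinate distributes over the
      linear combination of basis vectors.\<close>
    have "(Q *\<^sub>v w) $ i = w \<bullet> row Q i"
      using i Q w W' comm_scalar_prod [of w n "row Q i"] by auto
    also have "\<dots> = (\<Sum>b\<in>?A. (a b \<cdot>\<^sub>v b) \<bullet> row Q i)"
      unfolding a lincomb_def using A Q i by (intro finsum_scalar_prod_sum) auto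
    also have "\<dots> = 0"
      using A Q zero i by (intro sum.neutral ballI) (subst smult_scalar_prod_distrib [of _ n], auto)
    finally show ?thesis .
  qed
  show ?thesis
  proof (rule that [OF P Q(1) Q(3) Q(2) m(1)])
    assume "m = 0"
    then show "W = {0\<^sub>v n}" using m W' span_empty by auto
  next
    assume "m = n"
    then have "take m bs = bs" using bs by simp
    moreover have "basis (set bs)"
      using bs by (intro dim_li_is_basis) (auto simp: dim_is_n distinct_card)
    moreover have "span (set (take m bs)) \<subseteq> W"
      using m W' by (intro span_is_subset) auto
    ultimately show "W = carrier_vec n" using m W' by (auto simp: basis_def)
  next
    fix A i j
    assume A: "A \<in> carrier_mat n n" "\<forall>w\<in>W. A *\<^sub>v w \<in> W" and ij: "m \<le> i" "i < n" "j < m"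
    have "bs ! j \<in> W"
    proof -
      have "take m bs ! j \<in> set (take m bs)" using ij m(1) bs(1) by (intro nth_mem) simp
      then show ?thesis using m(2) ij by auto
    qed
    then have "A *\<^sub>v (bs ! j) \<in> W" using A by blast
    moreover have "(Q * (A * P)) $$ (i, j) = (Q *\<^sub>v (A *\<^sub>v (bs ! j))) $ i"
    proof -
      have j: "j < n" using ij by simp
      have "(Q * (A * P)) $$ (i, j) = col (Q * (A * P)) j $ i"
        using A P Q ij j by simp
      also have "col (Q * (A * P)) j = Q *\<^sub>v (A *\<^sub>v col P j)"
        by (simp only: col_mult2 [OF Q(1) mult_carrier_mat [OF A(1) P] j] col_mult2 [OF A(1) P j])
      finally show ?thesis using col_P [OF j] by simp
    qed
    ultimately show "(Q * (A * P)) $$ (i, j) = 0" using Q_W ij by simp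
  qed
qed

subsection \<open>Virtual characters as differences of characters\<close>

lemma virtual_charactersI:
  "finite S \<Longrightarrow> S \<subseteq> irreducible_characters G \<Longrightarrow> (\<lambda>g. \<Sum>\<chi>\<in>S. of_int (c \<chi>) * \<chi> g) \<in> virtual_characters G"
  unfolding virtual_characters_def by blast

lemma virtual_charactersE:
  assumes "x \<in> virtual_characters G"
  obtains S c where "finite S" "S \<subseteq> irreducible_characters G" "x = (\<lambda>g. \<Sum>\<chi>\<in>S. of_int (c \<chi>) * \<chi> g)"
  using assms unfolding virtual_characters_def by blast

lemma irreducible_in_virtual_characters:
  "\<chi> \<in> irreducible_characters G \<Longrightarrow> \<chi> \<in> virtual_characters G"
  using virtual_charactersI [of "{\<chi>}" G "\<lambda>_. 1"] by simp

lemma virtual_characters_0: "(\<lambda>g. 0) \<in> virtual_characters G"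
  using virtual_charactersI [of "{}" G] by simp

lemma virtual_characters_minus:
  assumes "x \<in> virtual_characters G"
  shows "(\<lambda>g. - x g) \<in> virtual_characters G"
proof -
  obtain S c where S: "finite S" "S \<subseteq> irreducible_characters G" "x = (\<lambda>g. \<Sum>\<chi>\<in>S. of_int (c \<chi>) * \<chi> g)"
    using assms by (rule virtual_charactersE)
  show ?thesis
    using virtual_charactersI [OF S(1,2), of "\<lambda>\<chi>. - c \<chi>"] S(3) by (simp add: sum_negf)
qed

lemma virtual_characters_add:
  assumes "x \<in> virtual_characters G" "y \<in> virtual_characters G"
  shows "(\<lambda>g. x g + y g) \<in> virtual_characters G"
proof -
  obtain S c where S: "finite S" "S \<subseteq> irreducible_characters G" "x = (\<lambda>g. \<Sum>\<chi>\<in>S. of_int (c \<chi>) * \<chi> g)"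
    using assms(1) by (rule virtual_charactersE)
  obtain T d where T: "finite T" "T \<subseteq> irreducible_characters G" "y = (\<lambda>g. \<Sum>\<chi>\<in>T. of_int (d \<chi>) * \<chi> g)"
    using assms(2) by (rule virtual_charactersE)
  define c' where "c' \<chi> = (if \<chi> \<in> S then c \<chi> else 0)" for \<chi>
  define d' where "d' \<chi> = (if \<chi> \<in> T then d \<chi> else 0)" for \<chi>
  have "x = (\<lambda>g. \<Sum>\<chi>\<in>S \<union> T. of_int (c' \<chi>) * \<chi> g)"
    unfolding S(3) using S T by (intro ext sum.mono_neutral_cong_left) (auto simp: c'_def)
  moreover have "y = (\<lambda>g. \<Sum>\<chi>\<in>S \<union> T. of_int (d' \<chi>) * \<chi> g)"
    unfolding T(3) using S T by (intro ext sum.mono_neutral_cong_left) (auto simp: d'_def)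
  ultimately show ?thesis
    using virtual_charactersI [of "S \<union> T" G "\<lambda>\<chi>. c' \<chi> + d' \<chi>"] S T
    by (simp add: sum.distrib algebra_simps)
qed

lemma character_similar:
  assumes "representation G d \<rho>" "P \<in> carrier_mat d d" "Q \<in> carrier_mat d d" "P * Q = 1\<^sub>m d" "Q * P = 1\<^sub>m d"
  shows "representation G d (\<lambda>g. Q * (\<rho> g * P))" "character G (\<lambda>g. Q * (\<rho> g * P)) = character G \<rho>"
proof -
  note carr = representation_carrier [OF assms(1)]
  have mult: "Q * (A * B * P) = (Q * (A * P)) * (Q * (B * P))" if "A \<in> carrier_mat d d" "B \<in> carrier_mat d d" for A B
  proof -
    have "(Q * (A * P)) * (Q * (B * P)) = Q * (A * ((P * Q) * (B * P)))"
      using that assms(2,3) by (simp add: assoc_mult_mat [of _ d d _ d _ d])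
    also have "\<dots> = Q * (A * B * P)"
      using that assms(2-4) by (simp add: assoc_mult_mat [of _ d d _ d _ d])
    finally show ?thesis ..
  qed
  show "representation G d (\<lambda>g. Q * (\<rho> g * P))"
    using assms carr unfolding representation_def by (auto simp: mult)
  have "mat_trace (Q * (A * P)) = mat_trace A" if A: "A \<in> carrier_mat d d" for A
  proof -
    have "mat_trace (Q * (A * P)) = mat_trace (A * P * Q)"
      using A assms by (intro mat_trace_mult_comm) auto
    also have "A * P * Q = A" using A assms by (simp add: assoc_mult_mat [of _ d d _ d _ d])
    finally show ?thesis .
  qed
  then show "character G (\<lambda>g. Q * (\<rho> g * P)) = character G \<rho>"
    using carr by (auto simp: character_def fun_eq_iff)
qed

text \<open>Each diagonal block is multiplicative because half of the split sum vanishes: for the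
  upper block by the zeros of \<open>\<rho> h\<close>, for the lower block by those of
  \<open>\<rho> g\<close>. The trace sees only the diagonal blocks.\<close>

lemma block_triangular_representation:
  fixes \<rho> :: "'g \<Rightarrow> 'k::field_char_0 mat"
  assumes \<rho>: "representation G d \<rho>" and m: "m \<le> d" and one: "\<one>\<^bsub>G\<^esub> \<in> carrier G"
    and block: "\<And>g i j. g \<in> carrier G \<Longrightarrow> m \<le> i \<Longrightarrow> i < d \<Longrightarrow> j < m \<Longrightarrow> \<rho> g $$ (i, j) = 0"
  obtains \<sigma> \<tau> where "representation G m \<sigma>" "representation G (d - m) \<tau>"
    "character G \<rho> = (\<lambda>g. character G \<sigma> g + character G \<tau> g)"
proof -
  let ?\<sigma> = "\<lambda>g. mat m m (\<lambda>(i, j). \<rho> g $$ (i, j))"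
  let ?\<tau> = "\<lambda>g. mat (d - m) (d - m) (\<lambda>(i, j). \<rho> g $$ (m + i, m + j))"
  note carr = representation_carrier [OF \<rho>]
  have split: "(\<Sum>k<d. f k) = (\<Sum>k<m. f k) + (\<Sum>k<d - m. f (m + k))" for f :: "nat \<Rightarrow> 'k"
  proof -
    have "(\<Sum>k<m + n. f k) = (\<Sum>k<m. f k) + (\<Sum>k<n. f (m + k))" for n
      by (induction n) (simp_all add: add.assoc)
    from this [of "d - m"] show ?thesis using m by simp
  qed
  have entry: "\<rho> (g \<otimes>\<^bsub>G\<^esub> h) $$ (i, j) = (\<Sum>k<m. \<rho> g $$ (i, k) * \<rho> h $$ (k, j))
      + (\<Sum>k<d - m. \<rho> g $$ (i, m + k) * \<rho> h $$ (m + k, j))"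
    if "g \<in> carrier G" "h \<in> carrier G" "i < d" "j < d" for g h i j
  proof -
    have "\<rho> (g \<otimes>\<^bsub>G\<^esub> h) $$ (i, j) = (\<Sum>k<d. \<rho> g $$ (i, k) * \<rho> h $$ (k, j))"
    proof -
      have "\<rho> (g \<otimes>\<^bsub>G\<^esub> h) = \<rho> g * \<rho> h" using \<rho> that by (simp add: representation_def)
      then show ?thesis using that carrier_matD [OF carr [OF that(1)]] carrier_matD [OF carr [OF that(2)]]
        by (simp add: scalar_prod_def atLeast0LessThan)
    qed
    then show ?thesis by (simp only: split)
  qed
  have "representation G m ?\<sigma>"
    unfolding representation_def
  proof (intro conjI ballI)
    show "?\<sigma> \<one>\<^bsub>G\<^esub> = 1\<^sub>m m"
      using \<rho> m by (intro eq_matI) (auto simp: representation_def)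
    fix g h assume gh: "g \<in> carrier G" "h \<in> carrier G"
    show "?\<sigma> (g \<otimes>\<^bsub>G\<^esub> h) = ?\<sigma> g * ?\<sigma> h"
      using gh m block [OF gh(2)]
      by (intro eq_matI) (simp_all add: entry scalar_prod_def atLeast0LessThan)
  qed auto
  moreover have "representation G (d - m) ?\<tau>"
    unfolding representation_def
  proof (intro conjI ballI)
    show "?\<tau> \<one>\<^bsub>G\<^esub> = 1\<^sub>m (d - m)"
      using \<rho> m by (intro eq_matI) (auto simp: representation_def)
    fix g h assume gh: "g \<in> carrier G" "h \<in> carrier G"
    show "?\<tau> (g \<otimes>\<^bsub>G\<^esub> h) = ?\<tau> g * ?\<tau> h"
      using gh m block [OF gh(1)]
      by (intro eq_matI) (simp_all add: entry scalar_prod_def atLeast0LessThan)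
  qed auto
  moreover have "character G \<rho> g = character G ?\<sigma> g + character G ?\<tau> g" for g
    by (simp add: character_def mat_trace_carrier [OF carr] split) (simp add: mat_trace_def)
  ultimately show ?thesis using that by blast
qed

text \<open>The constituents of a composition series have the same character sum as the representation,
  so semisimplicity is not needed.\<close>

lemma character_in_virtual_characters:
  fixes \<rho> :: "'g \<Rightarrow> 'k::field_char_0 mat"
  assumes "group G" and "representation G d \<rho>"
  shows "character G \<rho> \<in> virtual_characters G"
  using assms(2)
proof (induction d arbitrary: \<rho> rule: less_induct)
  case (less d)
  interpret group G by fact
  note carr = representation_carrier [OF less.prems]
  consider "d = 0" | "irreducible_representation G d \<rho>" | "d > 0" "\<not> irreducible_representation G d \<rho>"
    by blast
  then show ?case
  proof cases
    case 1
    then have "character G \<rho> = (\<lambda>g. 0)"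
      using carr by (auto simp: character_def mat_trace_carrier [of _ 0] fun_eq_iff)
    then show ?thesis using virtual_characters_0 by metis
  next
    case 2
    then show ?thesis
      by (intro irreducible_in_virtual_characters) (auto simp: irreducible_characters_def)
  next
    case 3
    then obtain W where W: "VectorSpace.subspace (class_ring :: 'k ring) W (module_vec TYPE('k) d)"
      and inv: "\<And>g. g \<in> carrier G \<Longrightarrow> \<forall>w\<in>W. \<rho> g *\<^sub>v w \<in> W" and "W \<noteq> {0\<^sub>v d}" "W \<noteq> carrier_vec d"
      using less.prems unfolding irreducible_representation_def by blast
    obtain P Q m where PQ: "P \<in> carrier_mat d d" "Q \<in> carrier_mat d d" "P * Q = 1\<^sub>m d" "Q * P = 1\<^sub>m d"
      and "m \<le> d" "m = 0 \<Longrightarrow> W = {0\<^sub>v d}" "m = d \<Longrightarrow> W = carrier_vec d"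
      and block: "\<And>A i j. A \<in> carrier_mat d d \<Longrightarrow> (\<forall>w\<in>W. A *\<^sub>v w \<in> W) \<Longrightarrow> m \<le> i \<Longrightarrow> i < d \<Longrightarrow> j < m
       \<Longrightarrow> (Q * (A * P)) $$ (i, j) = 0"
      using invariant_subspace_block_triangular [OF W] by blast
    \<comment> \<open>\<open>W\<close> is a proper nonzero subspace, so both blocks are smaller than
      \<open>d\<close> and fall under the induction hypothesis.\<close>
    then have m: "0 < m" "m < d" using \<open>W \<noteq> {0\<^sub>v d}\<close> \<open>W \<noteq> carrier_vec d\<close> by (auto simp: le_less)
    obtain \<sigma> \<tau> where "representation G m \<sigma>" "representation G (d - m) \<tau>"
      and sum: "character G (\<lambda>g. Q * (\<rho> g * P)) = (\<lambda>g. character G \<sigma> g + character G \<tau> g)"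
    proof (rule block_triangular_representation [OF character_similar(1) [OF less.prems PQ]])
      show "m \<le> d" using m by simp
      show "(Q * (\<rho> g * P)) $$ (i, j) = 0" if "g \<in> carrier G" "m \<le> i" "i < d" "j < m" for g i j
        using that carr inv by (intro block) auto
    qed auto
    then have "character G \<sigma> \<in> virtual_characters G" "character G \<tau> \<in> virtual_characters G"
      using m less.IH [of m \<sigma>] less.IH [of "d - m" \<tau>] by simp_all
    then have "character G (\<lambda>g. Q * (\<rho> g * P)) \<in> virtual_characters G"
      unfolding sum by (rule virtual_characters_add)
    then show ?thesis unfolding character_similar(2) [OF less.prems PQ] .
  qed
qed

text \<open>Differences of characters form an additive group containing the irreducible characters.
  This form transfers constructions on representations to the whole ring.\<close>

lemma virtual_character_difference:
  fixes x :: "'g \<Rightarrow> 'k::field_char_0"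
  assumes "x \<in> virtual_characters G"
  obtains a b where "a \<in> rep_characters G" "b \<in> rep_characters G" "x = (\<lambda>g. a g - b g)"
proof -
  define D where "D = {\<lambda>g. a g - b g | a b. a \<in> rep_characters G \<and> b \<in> (rep_characters G :: ('g \<Rightarrow> 'k) set)}"
  have DI: "(\<lambda>g. a g - b g) \<in> D" if "a \<in> rep_characters G" "b \<in> rep_characters G" for a b
    using that by (auto simp: D_def)
  have add: "(\<lambda>g. x g + y g) \<in> D" if xy: "x \<in> D" "y \<in> D" for x y
  proof -
    obtain a b a' b' where ab: "a \<in> rep_characters G" "b \<in> rep_characters G" "x = (\<lambda>g. a g - b g)"
      and ab': "a' \<in> rep_characters G" "b' \<in> rep_characters G" "y = (\<lambda>g. a' g - b' g)"
      using xy by (auto simp: D_def)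
    have "(\<lambda>g. (a g + a' g) - (b g + b' g)) \<in> D"
      using ab ab' by (intro DI rep_characters_add)
    then show ?thesis using ab ab' by (simp add: algebra_simps)
  qed
  have uminus: "(\<lambda>g. - x g) \<in> D" if "x \<in> D" for x
    using that by (auto simp: D_def) metis
  have zero: "(\<lambda>g. 0) \<in> D"
    using DI [OF rep_characters_0 rep_characters_0] by simp
  have nat: "(\<lambda>g. of_nat n * x g) \<in> D" if "x \<in> D" for x n
  proof (induction n)
    case (Suc n)
    then show ?case using add [OF that Suc] by (simp add: algebra_simps)
  qed (simp add: zero)
  have int: "(\<lambda>g. of_int k * x g) \<in> D" if "x \<in> D" for x k
  proof (cases k)
    case (nonneg n)
    then show ?thesis using nat [OF that, of n] by simp
  next
    case (neg n)
    have "(\<lambda>g. of_int k * x g) = (\<lambda>g. - (of_nat (Suc n) * x g))"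
      unfolding neg by (simp add: algebra_simps)
    then show ?thesis using uminus [OF nat [OF that, of "Suc n"]] by simp
  qed
  have irr: "\<chi> \<in> D" if "\<chi> \<in> irreducible_characters G" for \<chi>
  proof -
    have "\<chi> \<in> rep_characters G"
      using that by (auto simp: irreducible_characters_def rep_characters_def irreducible_representation_def)
    from DI [OF this rep_characters_0] show ?thesis by simp
  qed
  have "(\<lambda>g. \<Sum>\<chi>\<in>S. of_int (c \<chi>) * \<chi> g) \<in> D" if "finite S" "S \<subseteq> irreducible_characters G" for S c
    using that by (induction S) (simp_all add: zero add int irr)
  then have "x \<in> D" using assms by (elim virtual_charactersE) auto
  then show ?thesis using that by (auto simp: D_def)
qed

lemma rep_characters_subset: "group G \<Longrightarrow> rep_characters G \<subseteq> virtual_characters G"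
  by (auto simp: rep_characters_def intro: character_in_virtual_characters)

lemma virtual_characters_diff:
  assumes "x \<in> virtual_characters G" "y \<in> virtual_characters G"
  shows "(\<lambda>g. x g - y g) \<in> virtual_characters G"
  using virtual_characters_add [OF assms(1) virtual_characters_minus [OF assms(2)]] by simp

lemma virtual_characters_mult:
  assumes "group G" "x \<in> virtual_characters G" "y \<in> virtual_characters G"
  shows "(\<lambda>g. x g * y g) \<in> virtual_characters G"
proof -
  obtain a b where ab: "a \<in> rep_characters G" "b \<in> rep_characters G" "x = (\<lambda>g. a g - b g)"
    using assms(2) by (rule virtual_character_difference)
  obtain c d where cd: "c \<in> rep_characters G" "d \<in> rep_characters G" "y = (\<lambda>g. c g - d g)"
    using assms(3) by (rule virtual_character_difference)
  have "(\<lambda>g. (a g * c g + b g * d g) - (a g * d g + b g * c g)) \<in> virtual_characters G"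
    using ab cd rep_characters_subset [OF assms(1)]
    by (intro virtual_characters_diff) (blast intro: rep_characters_add rep_characters_mult)+
  then show ?thesis using ab cd by (simp add: algebra_simps)
qed

subsection \<open>The character ring and its exterior power operations\<close>

lemma character_ring_simps [simp]:
  "carrier (character_ring G) = virtual_characters G"
  "x \<otimes>\<^bsub>character_ring G\<^esub> y = (\<lambda>g. x g * y g)"
  "x \<oplus>\<^bsub>character_ring G\<^esub> y = (\<lambda>g. x g + y g)"
  "\<one>\<^bsub>character_ring G\<^esub> = (\<lambda>g. if g \<in> carrier G then 1 else 0)"
  "\<zero>\<^bsub>character_ring G\<^esub> = (\<lambda>g. 0)"
  by (simp_all add: character_ring_def)

lemma virtual_character_outside: "x \<in> virtual_characters G \<Longrightarrow> g \<notin> carrier G \<Longrightarrow> x g = 0"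
  by (erule virtual_character_difference) (auto simp: rep_characters_def character_def)

lemma virtual_characters_const:
  "group G \<Longrightarrow> (\<lambda>g. if g \<in> carrier G then of_nat d else 0) \<in> virtual_characters G"
  using rep_characters_subset rep_characters_const by blast

lemma virtual_characters_one:
  "group G \<Longrightarrow> (\<lambda>g. if g \<in> carrier G then 1 else 0) \<in> virtual_characters G"
  using virtual_characters_const [of G 1] by (simp cong: if_cong)

lemma cring_character_ring:
  fixes G :: "('g, 'b) monoid_scheme"
  assumes "group G"
  shows "cring (character_ring G :: ('g \<Rightarrow> 'k::field_char_0) ring)" (is "cring ?R")
proof (rule cringI)
  show "abelian_group ?R"
  proof (rule abelian_groupI)
    fix x assume "x \<in> carrier ?R"
    then show "\<exists>y\<in>carrier ?R. y \<oplus>\<^bsub>?R\<^esub> x = \<zero>\<^bsub>?R\<^esub>"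
      by (intro bexI [of _ "\<lambda>g. - x g"]) (simp_all add: virtual_characters_minus)
  qed (simp_all add: virtual_characters_add virtual_characters_0 algebra_simps)
  show "comm_monoid ?R"
  proof (rule comm_monoidI)
    fix x assume "x \<in> carrier ?R"
    \<comment> \<open>The unit is 0 outside the group, so this relies on virtual characters
      vanishing there.\<close>
    then show "\<one>\<^bsub>?R\<^esub> \<otimes>\<^bsub>?R\<^esub> x = x"
      by (auto simp: fun_eq_iff virtual_character_outside)
  qed (simp_all add: virtual_characters_mult virtual_characters_one assms algebra_simps)
qed (simp add: algebra_simps)

lemma finsum_character_ring:
  assumes "group G" "finite A" "f \<in> A \<rightarrow> virtual_characters G"
  shows "(\<Oplus>\<^bsub>character_ring G\<^esub>i\<in>A. f i) = (\<lambda>g. \<Sum>i\<in>A. f i g)"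
proof -
  interpret cring "character_ring G" by (rule cring_character_ring) fact
  show ?thesis
    using assms(2,3) by (induction A) (simp_all add: finsum_insert)
qed

text \<open>Evaluation is restricted to group elements because outside the group the empty product
  of the ring is 0 and that of the field is 1.\<close>

lemma finprod_character_ring:
  assumes "group G" "finite A" "f \<in> A \<rightarrow> virtual_characters G" "g \<in> carrier G"
  shows "(\<Otimes>\<^bsub>character_ring G\<^esub>i\<in>A. f i) g = (\<Prod>i\<in>A. f i g)"
proof -
  interpret cring "character_ring G" by (rule cring_character_ring) fact
  show ?thesis
    using assms(2-4) by (induction A) (simp_all add: finprod_insert)
qed

lemma virtual_characters_sum:
  assumes "group G" "finite A" "\<And>i. i \<in> A \<Longrightarrow> f i \<in> virtual_characters G"
  shows "(\<lambda>g. \<Sum>i\<in>A. f i g) \<in> virtual_characters G"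
  using assms(2,3) by (induction A) (simp_all add: virtual_characters_0 virtual_characters_add)

text \<open>The explicit candidate for \<open>lambda_op\<close>: Newton's polynomial in the Adams
  operations, which send x to g \<mapsto> x(g^k). The value 0 off the ring matches the convention
  that makes a lambda family unique.\<close>

definition exterior_op :: "('g, 'b) monoid_scheme \<Rightarrow> nat \<Rightarrow> ('g \<Rightarrow> 'k::field_char_0) \<Rightarrow> 'g \<Rightarrow> 'k" where
  "exterior_op G n x = (\<lambda>g. if x \<in> virtual_characters G \<and> g \<in> carrier G
     then elem_of_power_sums (\<lambda>k. x (g [^]\<^bsub>G\<^esub> k)) n else 0)"

lemma exterior_op_character:
  fixes \<rho> :: "'g \<Rightarrow> 'k::field_char_0 mat"
  assumes "group G" "representation G d \<rho>"
  shows "exterior_op G n (character G \<rho>) = character G (\<lambda>g. exterior_power_mat n (\<rho> g))"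
proof
  fix g
  have "exterior_op G n (character G \<rho>) g = elem_of_power_sums (\<lambda>k. character G \<rho> (g [^]\<^bsub>G\<^esub> k)) n"
    if "g \<in> carrier G"
    using that character_in_virtual_characters [OF assms] by (simp add: exterior_op_def)
  then show "exterior_op G n (character G \<rho>) g = character G (\<lambda>g. exterior_power_mat n (\<rho> g)) g"
    using character_exterior_power [OF assms, of g n]
    by (cases "g \<in> carrier G") (simp_all add: exterior_op_def [of G] character_def [of G "\<lambda>g. exterior_power_mat n (\<rho> g)"])
qed

lemma exterior_op_rep_characters:
  assumes "group G" "a \<in> rep_characters G"
  shows "exterior_op G n a \<in> rep_characters G"
proof -
  obtain d \<rho> where \<rho>: "representation G d \<rho>" "a = character G \<rho>"
    using assms(2) by (auto simp: rep_characters_def)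
  show ?thesis
    unfolding \<rho>(2) exterior_op_character [OF assms(1) \<rho>(1)]
    by (rule rep_charactersI) (rule representation_exterior_power [OF \<rho>(1)])
qed

lemma exterior_op_0: "x \<in> virtual_characters G \<Longrightarrow> exterior_op G 0 x = \<one>\<^bsub>character_ring G\<^esub>"
  by (simp add: exterior_op_def fun_eq_iff)

lemma exterior_op_add:
  assumes "x \<in> virtual_characters G" "y \<in> virtual_characters G"
  shows "exterior_op G n (\<lambda>g. x g + y g) = (\<lambda>g. \<Sum>i\<le>n. exterior_op G i x g * exterior_op G (n - i) y g)"
  using assms virtual_characters_add [OF assms]
  by (simp add: exterior_op_def fun_eq_iff elem_of_power_sums_add)

text \<open>The generating series of \<open>L n x\<close>, for \<open>x = a - b\<close> with characters \<open>a\<close> and \<open>b\<close>, is the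
  quotient of the series of \<open>a\<close> and \<open>b\<close>. Solving for its coefficients shows both that they are
  virtual characters and that they are determined by the values on characters.\<close>

lemma lambda_difference_recursion:
  fixes L :: "nat \<Rightarrow> ('g \<Rightarrow> 'k::field_char_0) \<Rightarrow> 'g \<Rightarrow> 'k"
  assumes "L 0 b = \<one>\<^bsub>character_ring G\<^esub>"
    and "L n (\<lambda>g. x g + b g) = (\<lambda>g. \<Sum>i\<le>n. L i x g * L (n - i) b g)"
    and "\<And>g. g \<notin> carrier G \<Longrightarrow> L n x g = 0"
  shows "L n x = (\<lambda>g. if g \<in> carrier G
           then L n (\<lambda>g. x g + b g) g - (\<Sum>i<n. L i x g * L (n - i) b g) else 0)"
proof
  fix g
  have "L n (\<lambda>g. x g + b g) g = (\<Sum>i<n. L i x g * L (n - i) b g) + L n x g" if "g \<in> carrier G"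
    unfolding assms(2) lessThan_Suc_atMost [symmetric] using that by (simp add: assms(1))
  then show "L n x g = (if g \<in> carrier G
      then L n (\<lambda>g. x g + b g) g - (\<Sum>i<n. L i x g * L (n - i) b g) else 0)"
    using assms(3) by simp
qed

lemma exterior_op_closed:
  assumes "group G" "x \<in> virtual_characters G"
  shows "exterior_op G n x \<in> virtual_characters G"
proof (induction n rule: less_induct)
  case (less n)
  obtain a b where ab: "a \<in> rep_characters G" "b \<in> rep_characters G" "x = (\<lambda>g. a g - b g)"
    using assms(2) by (rule virtual_character_difference)
  note sub = subsetD [OF rep_characters_subset [OF assms(1)]]
  have a: "(\<lambda>g. x g + b g) = a" using ab by simp
  have b: "b \<in> virtual_characters G" using ab sub by blast
  have "exterior_op G n x = (\<lambda>g. if g \<in> carrier G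
      then exterior_op G n a g - (\<Sum>i<n. exterior_op G i x g * exterior_op G (n - i) b g) else 0)"
    unfolding a [symmetric]
  proof (rule lambda_difference_recursion [OF exterior_op_0 [OF b] exterior_op_add [OF assms(2) b]])
    show "exterior_op G n x g = 0" if "g \<notin> carrier G" for g
      using that by (simp add: exterior_op_def)
  qed
  \<comment> \<open>Every \<open>exterior_op\<close> is 0 outside the group, so the case distinction
    disappears and the closure rules of the ring apply.\<close>
  also have "\<dots> = (\<lambda>g. exterior_op G n a g - (\<Sum>i<n. exterior_op G i x g * exterior_op G (n - i) b g))"
    by (auto simp: fun_eq_iff exterior_op_def)
  also have "\<dots> \<in> virtual_characters G"
    by (intro virtual_characters_diff virtual_characters_sum [OF assms(1)] virtual_characters_mult [OF assms(1)]
        less.IH sub [OF exterior_op_rep_characters [OF assms(1)]] ab(1,2)) auto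
  finally show ?case .
qed

lemma is_lambda_family_exterior_op:
  fixes G :: "('g, 'b) monoid_scheme"
  assumes "group G"
  shows "is_lambda_family G (exterior_op G :: nat \<Rightarrow> ('g \<Rightarrow> 'k::field_char_0) \<Rightarrow> 'g \<Rightarrow> 'k)"
proof -
  have add: "exterior_op G n (\<lambda>g. x g + y g)
      = (\<Oplus>\<^bsub>character_ring G\<^esub>i\<in>{..n}. exterior_op G i x \<otimes>\<^bsub>character_ring G\<^esub> exterior_op G (n - i) y)"
    if "x \<in> virtual_characters G" "y \<in> virtual_characters G" for n and x y :: "'g \<Rightarrow> 'k"
  proof -
    have "(\<lambda>i. exterior_op G i x \<otimes>\<^bsub>character_ring G\<^esub> exterior_op G (n - i) y) \<in> {..n} \<rightarrow> virtual_characters G"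
      using that assms by (auto intro!: virtual_characters_mult exterior_op_closed)
    from finsum_character_ring [OF assms finite_atMost this] show ?thesis
      by (simp only: exterior_op_add [OF that] character_ring_simps(2))
  qed
  show ?thesis
    unfolding is_lambda_family_def Let_def character_ring_simps(1,3,5)
  proof (intro conjI allI ballI impI)
    show "exterior_op G n x = (\<lambda>g. 0)" if "x \<notin> virtual_characters G" for n and x :: "'g \<Rightarrow> 'k"
      using that by (simp add: exterior_op_def)
  qed (assumption | rule add exterior_op_0 exterior_op_closed [OF assms] exterior_op_character [OF assms])+
qed

lemma is_lambda_familyD:
  assumes "is_lambda_family G L"
  shows "x \<in> virtual_characters G \<Longrightarrow> L n x \<in> virtual_characters G"
    and "x \<notin> virtual_characters G \<Longrightarrow> L n x = (\<lambda>g. 0)"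
    and "representation G d \<rho> \<Longrightarrow> L n (character G \<rho>) = character G (\<lambda>g. exterior_power_mat n (\<rho> g))"
    and "x \<in> virtual_characters G \<Longrightarrow> L 0 x = \<one>\<^bsub>character_ring G\<^esub>"
    and "x \<in> virtual_characters G \<Longrightarrow> y \<in> virtual_characters G \<Longrightarrow> L n (\<lambda>g. x g + y g)
       = (\<Oplus>\<^bsub>character_ring G\<^esub>i\<in>{..n}. L i x \<otimes>\<^bsub>character_ring G\<^esub> L (n - i) y)"
proof -
  note D = assms [unfolded is_lambda_family_def Let_def character_ring_simps(1,3,5)]
  show "x \<in> virtual_characters G \<Longrightarrow> L n x \<in> virtual_characters G"
    using D [THEN conjunct1] by blast
  show "x \<notin> virtual_characters G \<Longrightarrow> L n x = (\<lambda>g. 0)"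
    using D [THEN conjunct2, THEN conjunct1] by blast
  show "representation G d \<rho> \<Longrightarrow> L n (character G \<rho>) = character G (\<lambda>g. exterior_power_mat n (\<rho> g))"
    using D [THEN conjunct2, THEN conjunct2, THEN conjunct1] by blast
  show "x \<in> virtual_characters G \<Longrightarrow> L 0 x = \<one>\<^bsub>character_ring G\<^esub>"
    using D [THEN conjunct2, THEN conjunct2, THEN conjunct2, THEN conjunct1] by blast
  show "x \<in> virtual_characters G \<Longrightarrow> y \<in> virtual_characters G \<Longrightarrow> L n (\<lambda>g. x g + y g)
       = (\<Oplus>\<^bsub>character_ring G\<^esub>i\<in>{..n}. L i x \<otimes>\<^bsub>character_ring G\<^esub> L (n - i) y)"
    using D [THEN conjunct2, THEN conjunct2, THEN conjunct2, THEN conjunct2] by blast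
qed

lemma is_lambda_family_unique:
  fixes L M :: "nat \<Rightarrow> ('g \<Rightarrow> 'k::field_char_0) \<Rightarrow> 'g \<Rightarrow> 'k"
  assumes "group G" and L: "is_lambda_family G L" and M: "is_lambda_family G M"
  shows "L = M"
proof -
  have add: "K n (\<lambda>g. x g + y g) = (\<lambda>g. \<Sum>i\<le>n. K i x g * K (n - i) y g)"
    if K: "is_lambda_family G K" and xy: "x \<in> virtual_characters G" "y \<in> virtual_characters G"
    for K n and x y :: "'g \<Rightarrow> 'k"
  proof -
    have "(\<lambda>i. K i x \<otimes>\<^bsub>character_ring G\<^esub> K (n - i) y) \<in> {..n} \<rightarrow> virtual_characters G"
      using is_lambda_familyD(1) [OF K] xy assms(1) by (simp add: virtual_characters_mult)
    from finsum_character_ring [OF assms(1) finite_atMost this] show ?thesis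
      unfolding is_lambda_familyD(5) [OF K xy] by simp
  qed
  have rep: "L n a = M n a" if a: "a \<in> rep_characters G" for n a
  proof -
    obtain d \<rho> where \<rho>: "representation G d \<rho>" "a = character G \<rho>"
      using a unfolding rep_characters_def by blast
    show ?thesis
      unfolding \<rho>(2) is_lambda_familyD(3) [OF L \<rho>(1)] is_lambda_familyD(3) [OF M \<rho>(1)] ..
  qed
  have "L n x = M n x" if x: "x \<in> virtual_characters G" for n x
  proof (induction n rule: less_induct)
    case (less n)
    obtain a b where ab: "a \<in> rep_characters G" "b \<in> rep_characters G" "x = (\<lambda>g. a g - b g)"
      using x by (rule virtual_character_difference)
    then have b: "b \<in> virtual_characters G" using rep_characters_subset [OF assms(1)] by auto
    have a: "(\<lambda>g. x g + b g) = a" using ab by simp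
    have *: "K n x = (\<lambda>g. if g \<in> carrier G
        then K n a g - (\<Sum>i<n. K i x g * K (n - i) b g) else 0)" if K: "is_lambda_family G K" for K
      unfolding a [symmetric]
      using is_lambda_familyD(4) [OF K b] add [OF K x b] virtual_character_outside [OF is_lambda_familyD(1) [OF K x]]
      by (rule lambda_difference_recursion [of K b G n x])
    \<comment> \<open>The right-hand sides involve \<open>L\<close> and \<open>M\<close> only on
      characters, where they agree, and at \<open>x\<close> in degrees below
      \<open>n\<close>.\<close>
    show ?case unfolding * [OF L] * [OF M]
      using less by (simp add: rep [OF ab(1)] rep [OF ab(2)] cong: if_cong)
  qed
  moreover have "L n x = M n x" if "x \<notin> virtual_characters G" for n x
    using that is_lambda_familyD(2) [OF L] is_lambda_familyD(2) [OF M] by simp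
  ultimately have "L n x = M n x" for n x by (cases "x \<in> virtual_characters G")
  then show ?thesis by (intro ext) simp
qed

lemma lambda_op_eq: "group G \<Longrightarrow> lambda_op G = exterior_op G"
  unfolding lambda_op_def
  by (rule the_equality, rule is_lambda_family_exterior_op, assumption)
    (rule is_lambda_family_unique, assumption, assumption, rule is_lambda_family_exterior_op)

subsection \<open>The gamma filtration\<close>

lemma virtual_character_one_int:
  assumes "group G" "x \<in> virtual_characters G"
  obtains k :: int where "x \<one>\<^bsub>G\<^esub> = of_int k"
proof -
  interpret group G by fact
  have nat: "\<exists>d. a \<one>\<^bsub>G\<^esub> = of_nat d" if a: "a \<in> rep_characters G" for a :: "'a \<Rightarrow> 'c"
  proof -
    obtain d \<rho> where \<rho>: "representation G d \<rho>" "a = character G \<rho>"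
      using a unfolding rep_characters_def by blast
    then have "a \<one>\<^bsub>G\<^esub> = of_nat d"
      by (simp add: character_def representation_def mat_trace_def)
    then show ?thesis by blast
  qed
  obtain a b where ab: "a \<in> rep_characters G" "b \<in> rep_characters G" "x = (\<lambda>g. a g - b g)"
    using assms(2) by (rule virtual_character_difference)
  obtain m n where "a \<one>\<^bsub>G\<^esub> = of_nat m" "b \<one>\<^bsub>G\<^esub> = of_nat n"
    using nat [OF ab(1)] nat [OF ab(2)] by blast
  then show ?thesis using ab that [of "int m - int n"] by simp
qed

text \<open>The value at the identity is an integer, and integers embed injectively in
  characteristic zero, so the definite description of the degree is meaningful.\<close>

lemma augmentation_ideal_iff:
  assumes "group G"
  shows "x \<in> augmentation_ideal G \<longleftrightarrow> x \<in> virtual_characters G \<and> x \<one>\<^bsub>G\<^esub> = 0"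
proof -
  have "augmentation G x = 0 \<longleftrightarrow> x \<one>\<^bsub>G\<^esub> = 0" if x: "x \<in> virtual_characters G"
  proof -
    obtain k :: int where k: "x \<one>\<^bsub>G\<^esub> = of_int k"
      using virtual_character_one_int [OF assms x] by blast
    then have "augmentation G x = k" by (simp add: augmentation_def)
    then show ?thesis using k by simp
  qed
  then show ?thesis by (auto simp: augmentation_ideal_def)
qed

text \<open>All power sums of d ones equal d, so this is the binomial coefficient (d choose n). It
  is computed as the trace of an exterior power of the identity matrix, whose basis is empty for n >
  d.\<close>

lemma elem_of_power_sums_const:
  assumes "d < n"
  shows "elem_of_power_sums (\<lambda>k. of_nat d) n = (0 :: 'a::field_char_0)"
proof -
  have pow: "(1\<^sub>m d :: 'a mat) ^\<^sub>m k = 1\<^sub>m d" for k by (induction k) auto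
  have "exterior_basis n d = []"
  proof (rule ccontr)
    assume "exterior_basis n d \<noteq> []"
    then obtain l where "l \<in> set (exterior_basis n d)" using hd_in_set by blast
    then have l: "set l \<subseteq> {..<d}" "length l = n" "distinct l"
      by (auto simp: in_exterior_basis_iff index_lists_def)
    then have "n \<le> d" using card_mono [OF _ l(1)] distinct_card [OF l(3)] by simp
    then show False using assms by simp
  qed
  then have "mat_trace (exterior_power_mat n (1\<^sub>m d :: 'a mat)) = 0"
    by (simp add: exterior_power_mat_one mat_trace_def)
  then show ?thesis
    using trace_exterior_power_eq_elem [of "1\<^sub>m d :: 'a mat" d n] by (simp add: pow) (simp add: mat_trace_def)
qed

lemma add_pow_character_ring_one:
  assumes "group G"
  shows "add_pow (character_ring G) (int n) \<one>\<^bsub>character_ring G\<^esub> = (\<lambda>g. if g \<in> carrier G then of_nat n else 0)"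
proof -
  interpret cring "character_ring G" by (rule cring_character_ring) fact
  have "add_pow (character_ring G) n \<one>\<^bsub>character_ring G\<^esub> = (\<lambda>g. if g \<in> carrier G then of_nat n else 0)"
    by (induction n) (auto simp: add_pow_def fun_eq_iff)
  then show ?thesis by (simp only: add_pow_int_ge [OF of_nat_0_le_iff] nat_int)
qed

lemma gamma_op_closed:
  fixes x :: "'g \<Rightarrow> 'k::field_char_0"
  assumes "group G" "x \<in> virtual_characters G"
  shows "gamma_op G n x \<in> virtual_characters G"
proof -
  interpret cring "character_ring G :: ('g \<Rightarrow> 'k) ring" by (rule cring_character_ring) fact
  have "add_pow (character_ring G) (int n - 1) \<one>\<^bsub>character_ring G\<^esub> \<in> (virtual_characters G :: ('g \<Rightarrow> 'k) set)"
    using add.int_pow_closed [OF one_closed, of "int n - 1"] by simp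
  then show ?thesis
    unfolding gamma_op_def Let_def lambda_op_eq [OF assms(1)]
    using assms by (intro exterior_op_closed) (simp_all add: virtual_characters_add)
qed

text \<open>In positive degree the shift is a natural number, so the added constant is a trivial
  character.\<close>

lemma gamma_op_Suc:
  fixes x :: "'g \<Rightarrow> 'k::field_char_0"
  assumes "group G"
  shows "gamma_op G (Suc n) x = exterior_op G (Suc n) (\<lambda>g. x g + (if g \<in> carrier G then of_nat n else 0))"
proof -
  have "add_pow (character_ring G) (int n) \<one>\<^bsub>character_ring G\<^esub>
      = (\<lambda>g. if g \<in> carrier G then of_nat n else 0 :: 'k)"
    by (rule add_pow_character_ring_one [OF assms])
  then show ?thesis unfolding gamma_op_def Let_def lambda_op_eq [OF assms] by simp
qed

lemma gamma_op_1:
  assumes "group G" "x \<in> virtual_characters G"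
  shows "gamma_op G 1 x = x"
proof
  interpret group G by fact
  fix g
  show "gamma_op G 1 x g = x g"
    using assms(2) virtual_character_outside [OF assms(2), of g] unfolding One_nat_def gamma_op_Suc [OF assms(1)]
    by (simp add: exterior_op_def elem_of_power_sums.simps(2) cong: if_cong)
qed

lemma gamma_op_one_eq_0:
  assumes "group G" "x \<in> augmentation_ideal G" "0 < n"
  shows "gamma_op G n x \<one>\<^bsub>G\<^esub> = 0"
proof -
  interpret group G by fact
  obtain m where n: "n = Suc m" using assms(3) by (cases n) auto
  have x: "x \<one>\<^bsub>G\<^esub> = 0" using assms by (simp add: augmentation_ideal_iff)
  \<comment> \<open>All power sums at the identity are \<open>m\<close>, the shift, since
    \<open>x\<close> vanishes there. The second alternative covers the default value of
    \<open>exterior_op\<close>.\<close>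
  have "gamma_op G n x \<one>\<^bsub>G\<^esub> = elem_of_power_sums (\<lambda>k. of_nat m) (Suc m) \<or> gamma_op G n x \<one>\<^bsub>G\<^esub> = 0"
    unfolding n gamma_op_Suc [OF assms(1)] by (auto simp: exterior_op_def x)
  then show ?thesis by (auto simp: elem_of_power_sums_const)
qed

section \<open>Products of gamma operations and the subgroups they generate\<close>

definition gamma_products :: "('g, 'b) monoid_scheme \<Rightarrow> nat \<Rightarrow> ('g \<Rightarrow> 'k::field_char_0) set" where
  "gamma_products G n = {\<Otimes>\<^bsub>character_ring G\<^esub>j\<in>{..<r}. gamma_op G (i j) (x j) | (r :: nat) i x.
     (\<forall>j<r. x j \<in> augmentation_ideal G) \<and> n \<le> (\<Sum>j<r. i j)}"

lemma gamma_filtration_eq: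
  "gamma_filtration G n = generate (add_monoid (character_ring G)) (gamma_products G n)"
  by (simp add: gamma_filtration_def gamma_products_def)

lemma gamma_op_augmentation_closed:
  "group G \<Longrightarrow> x \<in> augmentation_ideal G \<Longrightarrow> gamma_op G n x \<in> virtual_characters G"
  by (simp add: gamma_op_closed augmentation_ideal_iff)

lemma gamma_products_closed:
  assumes "group G"
  shows "gamma_products G n \<subseteq> virtual_characters G"
proof
  fix p :: "'a \<Rightarrow> 'c" assume "p \<in> gamma_products G n"
  then obtain r :: nat and i x where p: "p = (\<Otimes>\<^bsub>character_ring G\<^esub>j\<in>{..<r}. gamma_op G (i j) (x j))"
    and x: "\<forall>j<r. x j \<in> augmentation_ideal G"
    unfolding gamma_products_def by blast
  interpret cring "character_ring G :: ('a \<Rightarrow> 'c) ring" by (rule cring_character_ring) fact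
  show "p \<in> virtual_characters G"
    unfolding p using finprod_closed [of "\<lambda>j. gamma_op G (i j) (x j)" "{..<r}"] x
    by (simp add: gamma_op_augmentation_closed [OF assms] Pi_def)
qed

lemma gamma_products_one_eq_0:
  assumes "group G" "p \<in> gamma_products G n" "0 < n"
  shows "p \<one>\<^bsub>G\<^esub> = 0"
proof -
  interpret group G by fact
  obtain r :: nat and i x where p: "p = (\<Otimes>\<^bsub>character_ring G\<^esub>j\<in>{..<r}. gamma_op G (i j) (x j))"
    and x: "\<forall>j<r. x j \<in> augmentation_ideal G" and n: "n \<le> (\<Sum>j<r. i j)"
    using assms(2) unfolding gamma_products_def by blast
  \<comment> \<open>Factors of index 0 may occur and need not vanish at the identity; the positive
    total weight provides one that does.\<close>
  have "\<exists>j<r. 0 < i j"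
  proof (rule ccontr)
    assume "\<not> (\<exists>j<r. 0 < i j)"
    then have "(\<Sum>j<r. i j) = 0" by auto
    then show False using n assms(3) by simp
  qed
  then have "(\<Prod>j<r. gamma_op G (i j) (x j) \<one>\<^bsub>G\<^esub>) = 0"
    using gamma_op_one_eq_0 [OF assms(1)] x by (auto simp: prod_zero_iff)
  moreover have "(\<lambda>j. gamma_op G (i j) (x j)) \<in> {..<r} \<rightarrow> virtual_characters G"
    using x by (simp add: gamma_op_augmentation_closed [OF assms(1)])
  ultimately show ?thesis
    unfolding p by (subst finprod_character_ring [OF assms(1)]) auto
qed

lemma gamma_products_mult:
  assumes "group G" "p \<in> gamma_products G n" "y \<in> augmentation_ideal G"
  shows "(\<lambda>g. p g * y g) \<in> gamma_products G (Suc n)"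
proof -
  obtain r :: nat and i x where p: "p = (\<Otimes>\<^bsub>character_ring G\<^esub>j\<in>{..<r}. gamma_op G (i j) (x j))"
    and x: "\<forall>j<r. x j \<in> augmentation_ideal G" and n: "n \<le> (\<Sum>j<r. i j)"
    using assms(2) unfolding gamma_products_def by blast
  interpret cring "character_ring G :: ('a \<Rightarrow> 'c) ring" by (rule cring_character_ring) fact
  \<comment> \<open>The appended factor is \<gamma>^1(y) = y, which raises the weight by
    one.\<close>
  let ?i = "i(r := 1)" and ?x = "x(r := y)"
  have y: "y \<in> virtual_characters G" using assms by (simp add: augmentation_ideal_iff)
  have "(\<Otimes>\<^bsub>character_ring G\<^esub>j\<in>{..<Suc r}. gamma_op G (?i j) (?x j))
      = gamma_op G 1 y \<otimes>\<^bsub>character_ring G\<^esub> (\<Otimes>\<^bsub>character_ring G\<^esub>j\<in>{..<r}. gamma_op G (?i j) (?x j))"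
    using x y unfolding lessThan_Suc
    by (subst finprod_insert) (auto simp: gamma_op_augmentation_closed [OF assms(1)] gamma_op_1 [OF assms(1), simplified])
  also have "(\<Otimes>\<^bsub>character_ring G\<^esub>j\<in>{..<r}. gamma_op G (?i j) (?x j)) = p"
    unfolding p using x by (intro finprod_cong') (auto simp: gamma_op_augmentation_closed [OF assms(1)])
  finally have "(\<lambda>g. p g * y g) = (\<Otimes>\<^bsub>character_ring G\<^esub>j\<in>{..<Suc r}. gamma_op G (?i j) (?x j))"
    by (simp add: gamma_op_1 [OF assms(1) y] mult.commute del: One_nat_def)
  moreover have "\<forall>j<Suc r. ?x j \<in> augmentation_ideal G" using x assms(3) by simp
  moreover have "Suc n \<le> (\<Sum>j<Suc r. ?i j)" using n by simp
  ultimately show ?thesis unfolding gamma_products_def by blast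
qed

lemma gamma_filtration_subgroup:
  assumes "group G"
  shows "subgroup (gamma_filtration G n) (add_monoid (character_ring G))"
proof -
  interpret cring "character_ring G" by (rule cring_character_ring) fact
  show ?thesis unfolding gamma_filtration_eq
    using gamma_products_closed [OF assms] by (intro add.generate_is_subgroup) auto
qed

lemma gamma_filtration_closed:
  "group G \<Longrightarrow> gamma_filtration G n \<subseteq> virtual_characters G"
  using subgroup.subset [OF gamma_filtration_subgroup] by fastforce

lemma gamma_filtration_antimono:
  assumes "group G" "m \<le> n"
  shows "gamma_filtration G n \<subseteq> gamma_filtration G m"
proof -
  interpret cring "character_ring G" by (rule cring_character_ring) fact
  show ?thesis
    unfolding gamma_filtration_eq
  proof (rule add.mono_generate)
    show "gamma_products G n \<subseteq> gamma_products G m"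
      unfolding gamma_products_def using assms(2) by (auto intro: order_trans)
  qed
qed

lemma a_inv_character_ring:
  assumes "group G" "x \<in> virtual_characters G"
  shows "\<ominus>\<^bsub>character_ring G\<^esub> x = (\<lambda>g. - x g)"
proof -
  interpret cring "character_ring G" by (rule cring_character_ring) fact
  show ?thesis
    using assms(2) by (intro minus_equality) (simp_all add: virtual_characters_minus)
qed

text \<open>\<open>generate\<close> inverts generators only, so negation is asked for generators
  alone; inverses in the additive monoid are translated into pointwise negation.\<close>

lemma gamma_filtration_induct [consumes 2, case_names zero incl minus add]:
  assumes "group G" "x \<in> gamma_filtration G n"
    and "P (\<lambda>g. 0)"
    and "\<And>x. x \<in> gamma_products G n \<Longrightarrow> P x"
    and "\<And>x. x \<in> gamma_products G n \<Longrightarrow> P (\<lambda>g. - x g)"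
    and "\<And>x y. P x \<Longrightarrow> P y \<Longrightarrow> P (\<lambda>g. x g + y g)"
  shows "P x"
  using assms(2) unfolding gamma_filtration_eq
proof (induction rule: generate.induct)
  case (inv h)
  have "inv\<^bsub>add_monoid (character_ring G)\<^esub> h = (\<lambda>g. - h g)"
    using a_inv_character_ring [OF assms(1), of h] gamma_products_closed [OF assms(1)] inv
    unfolding a_inv_def by blast
  then show ?case using assms(5) [OF inv] by simp
qed (use assms in simp_all)

lemma gamma_filtration_one_eq_0:
  assumes "group G" "x \<in> gamma_filtration G n" "0 < n"
  shows "x \<one>\<^bsub>G\<^esub> = 0"
  using assms(1,2)
  by (induction rule: gamma_filtration_induct) (simp_all add: gamma_products_one_eq_0 [OF assms(1) _ assms(3)])

lemma gamma_filtration_mult: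
  assumes "group G" "x \<in> gamma_filtration G n" "y \<in> augmentation_ideal G"
  shows "(\<lambda>g. x g * y g) \<in> gamma_filtration G (Suc n)"
proof -
  interpret subgroup "gamma_filtration G (Suc n)" "add_monoid (character_ring G)"
    by (rule gamma_filtration_subgroup) fact
  have incl: "(\<lambda>g. p g * y g) \<in> gamma_filtration G (Suc n)" if "p \<in> gamma_products G n" for p
    unfolding gamma_filtration_eq using gamma_products_mult [OF assms(1) that assms(3)] by (rule generate.incl)
  show ?thesis
    using assms(1,2)
  proof (induction rule: gamma_filtration_induct)
    case zero
    show ?case using one_closed by simp
  next
    case (incl p)
    then show ?case by (rule \<open>\<And>p. p \<in> gamma_products G n \<Longrightarrow> _\<close>)
  next
    case (minus p)
    have p: "(\<lambda>g. p g * y g) \<in> gamma_filtration G (Suc n)" using minus by (rule incl)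
    then have "\<ominus>\<^bsub>character_ring G\<^esub> (\<lambda>g. p g * y g) \<in> gamma_filtration G (Suc n)"
      unfolding a_inv_def by (rule m_inv_closed)
    then show ?case
      by (simp only: a_inv_character_ring [OF assms(1) subsetD [OF gamma_filtration_closed [OF assms(1)] p]]
          mult_minus_left)
  next
    case (add u v)
    then show ?case using m_closed [of "\<lambda>g. u g * y g" "\<lambda>g. v g * y g"] by (simp add: distrib_right)
  qed
qed

text \<open>Multiplication by \<open>|G| - reg\<close>, with \<open>reg\<close> the regular character, is multiplication by \<open>|G|\<close>
  on the characters vanishing at the identity.\<close>

lemma card_mult_gamma_filtration:
  assumes "group G" "finite (carrier G)" "0 < n" "x \<in> gamma_filtration G n"
  shows "(\<lambda>g. of_nat (card (carrier G)) * x g) \<in> gamma_filtration G (Suc n)"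
proof -
  interpret group G by fact
  let ?N = "of_nat (card (carrier G)) :: 'c"
  define y :: "'a \<Rightarrow> 'c" where "y g = (if g \<in> carrier G then ?N else 0) - (if g = \<one>\<^bsub>G\<^esub> then ?N else 0)" for g
  have "y \<in> virtual_characters G"
    unfolding y_def using virtual_characters_const [OF assms(1)] rep_characters_regular [OF assms(1,2)]
      rep_characters_subset [OF assms(1)]
    by (intro virtual_characters_diff) blast+
  then have "y \<in> augmentation_ideal G"
    by (simp add: augmentation_ideal_iff [OF assms(1)] y_def)
  then have "(\<lambda>g. x g * y g) \<in> gamma_filtration G (Suc n)"
    by (rule gamma_filtration_mult [OF assms(1,4)])
  \<comment> \<open>At the identity and outside the group \<open>x\<close> is 0; at all other group
    elements \<open>y\<close> equals |G|.\<close>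
  also have "(\<lambda>g. x g * y g) = (\<lambda>g. ?N * x g)"
  proof
    fix g
    have "x g = 0" if "g \<notin> carrier G"
      using that gamma_filtration_closed [OF assms(1)] assms(4) by (blast intro: virtual_character_outside)
    then show "x g * y g = ?N * x g"
      using gamma_filtration_one_eq_0 [OF assms(1,4,3)] by (auto simp: y_def)
  qed
  finally show ?thesis .
qed

theorem proposition2p6:
  fixes G :: "('g, 'b) monoid_scheme"
    and n :: nat
    and z :: "('g \<Rightarrow> 'k::field_char_0) set"
  assumes "group G" and "finite (carrier G)"
    and "n > 0"
    and "z \<in> carrier (graded_piece G n)"
  shows "z [^]\<^bsub>graded_piece G n\<^esub> card (carrier G) = \<one>\<^bsub>graded_piece G n\<^esub>"
proof -
  let ?R = "character_ring G :: ('g \<Rightarrow> 'k) ring"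
  let ?H = "gamma_filtration G (Suc n) :: ('g \<Rightarrow> 'k) set"
  let ?K = "add_monoid ?R \<lparr>carrier := gamma_filtration G n\<rparr>"
  interpret R: cring ?R by (rule cring_character_ring) fact
  interpret K: group ?K
    by (rule R.add.subgroup_imp_group) (rule gamma_filtration_subgroup [OF assms(1)])
  interpret K: comm_group ?K
    by (rule K.group_comm_groupI) (simp add: add.commute)
  have H: "subgroup ?H ?K"
    by (intro R.add.subgroup_incl gamma_filtration_subgroup assms gamma_filtration_antimono) simp
  interpret normal ?H ?K by (rule K.subgroup_imp_normal [OF H])
  obtain x where x: "x \<in> gamma_filtration G n" "z = ?H #>\<^bsub>?K\<^esub> x"
    using assms(4) unfolding graded_piece_def FactGroup_def RCOSETS_def by auto
  interpret proj: group_hom ?K "?K Mod ?H" "\<lambda>a. ?H #>\<^bsub>?K\<^esub> a"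
    by (intro group_hom.intro group_hom_axioms.intro K.is_group factorgroup_is_group r_coset_hom_Mod)
  \<comment> \<open>Powers in the multiplicatively written additive group are integer multiples, so
    the power of a coset is the coset of |G| x, which lies in \<open>?H\<close>.\<close>
  have pow: "x [^]\<^bsub>?K\<^esub> k = (\<lambda>g. of_nat k * x g)" for k :: nat
    by (induction k) (simp_all add: algebra_simps)
  have "z [^]\<^bsub>?K Mod ?H\<^esub> card (carrier G) = ?H #>\<^bsub>?K\<^esub> (x [^]\<^bsub>?K\<^esub> card (carrier G))"
    unfolding x(2) by (rule proj.hom_nat_pow [symmetric]) (use x in simp)
  also have "\<dots> = ?H"
    unfolding pow using card_mult_gamma_filtration [OF assms(1,2,3) x(1)]
    by (intro K.coset_join2 H) (use gamma_filtration_antimono [OF assms(1), of n "Suc n"] in auto)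
  finally show ?thesis unfolding graded_piece_def by simp
qed

end
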